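(* Let $n\geq 4$ be an even integer. Then $L_n$ is a basic strong CR tournament.
   Context: A tournament is a digraph with exactly one arc between each pair of distinct vertices. For $n\ge2$, $L_n$ is the $n$-tournament with vertices $v_1,\dots,v_n$ such that for $1\le i<j\le n-1$, $v_i\to v_j$, and for $1\le i\le n-1$, $v_n\to v_i$ if $i$ is odd and $v_i\to v_n$ if $i$ is even. For distinct vertices write $\theta_T(u,v)=1$ if $u\to v$, $-1$ otherwise. Skew-adjacency matrix $S_T$: entry $1$ if $v_i\to v_j$, $-1$ if $v_j\to v_i$, $0$ on the diagonal; $\det(T)=\det(S_T)$. For odd $k\ge1$, $\mathcal{D}_k$ is the set of tournaments all of whose induced subtournaments have determinant at most $k^2$; $\mathcal{D}_{-1}=\emptyset$. Transitive blowup: for $T$ on $v_1,\dots,v_n$ and positive integers $a_i$, replace each $v_i$ by a transitive tournament on $a_i$ vertices, with all arcs from the $i$-th block to the $j$-th block whenever $v_i\to v_j$; a 1-transitive blowup has one $a_i=2$ and the others $1$. A diamond is a 4-tournament consisting of a 3-cycle plus a vertex dominating all of it or dominated by all of it. Two vertices $u_1,u_2$ of $T$ are covertices and revertices if $|V(T)|=2$; if $|V(T)|\ge3$ they are covertices if $\theta_T(u_1,v)=\theta_T(u_2,v)$ for all other $v$, revertices if $\theta_T(u_1,v)=-\theta_T(u_2,v)$ for all other $v$; CR-associated if covertices or revertices. For $u\notin V(T)=\{w_1,\dots,w_n\}$ and $\sigma=(r_1,\dots,r_n)\in\{\pm1\}^n$, $T(u,\sigma)$ extends $T$ by $u$ with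 $u\to w_i$ iff $r_i=1$; $u$ is a CR vertex for $T$ with $\sigma$ if $u$ is CR-associated in $T(u,\sigma)$ with some vertex of $T$, otherwise a non-CR vertex. Let $T\in\mathcal{D}_k\setminus\mathcal{D}_{k-2}$, $k$ odd. $T$ is a CR tournament if $T$ is a 1-tournament, a 2-tournament or a diamond, or else for every $u\notin V(T)$ and every $\sigma$ with $u$ a non-CR vertex for $T$ with $\sigma$, $T(u,\sigma)\notin\mathcal{D}_k$. A strong CR tournament is a CR tournament all of whose 1-transitive blowups are CR tournaments. A tournament of order at least 4 is basic if no two of its vertices are CR-associated. *)

theory Defs
  imports
    "Graph_Theory.Pair_Digraph"
    "Graph_Theory.Digraph_Component"
    "Jordan_Normal_Form.Determinant"
    "HOL-Library.Infinite_Typeclass"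
begin

definition tournament :: "'a pair_pre_digraph \<Rightarrow> bool" where
  "tournament T \<longleftrightarrow> pair_digraph T \<and>
     (\<forall>u\<in>pverts T. \<forall>v\<in>pverts T. u \<noteq> v \<longrightarrow> ((u, v) \<in> parcs T) \<noteq> ((v, u) \<in> parcs T))"

definition L_tournament :: "nat \<Rightarrow> nat pair_pre_digraph" where
  "L_tournament n = \<lparr> pverts = {1..n},
     parcs = {(i, j). 1 \<le> i \<and> i < j \<and> j \<le> n - 1}
           \<union> {(n, i) | i. 1 \<le> i \<and> i \<le> n - 1 \<and> odd i}
           \<union> {(i, n) | i. 1 \<le> i \<and> i \<le> n - 1 \<and> even i} \<rparr>"

definition theta :: "'a pair_pre_digraph \<Rightarrow> 'a \<Rightarrow> 'a \<Rightarrow> int" where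
  "theta T u v = (if (u, v) \<in> parcs T then 1 else - 1)"

text \<open>The skew-adjacency matrix with respect to an enumeration \<open>vs\<close> of the vertices.\<close>

definition skew_adj_mat :: "'a pair_pre_digraph \<Rightarrow> 'a list \<Rightarrow> int mat" where
  "skew_adj_mat T vs = mat (length vs) (length vs)
     (\<lambda>(i, j). if (vs ! i, vs ! j) \<in> parcs T then 1
               else if (vs ! j, vs ! i) \<in> parcs T then - 1 else 0)"

text \<open>The choice of the enumeration is immaterial, see \<open>tdet_eq\<close> below.\<close>

definition tdet :: "'a pair_pre_digraph \<Rightarrow> int" where
  "tdet T = det (skew_adj_mat T (SOME vs. distinct vs \<and> set vs = pverts T))"

lemma det_permute_rows_cols:
  fixes A :: "'b :: comm_ring_1 mat"
  assumes A: "A \<in> carrier_mat n n" and p: "p permutes {0..<n}"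
  shows "det (mat n n (\<lambda>(i, j). A $$ (p i, p j))) = det A"
proof -
  have pl: "i < n \<Longrightarrow> p i < n" for i
    using permutes_in_image[OF p, of i] by simp
  define B where "B = mat n n (\<lambda>(i, j). A $$ (p i, j))"
  have B: "B \<in> carrier_mat n n" by (simp add: B_def)
  have eq: "mat n n (\<lambda>(i, j). A $$ (p i, p j))
      = transpose_mat (mat n n (\<lambda>(i, j). transpose_mat B $$ (p i, j)))"
    by (rule eq_matI) (auto simp: B_def pl)
  have "det (mat n n (\<lambda>(i, j). A $$ (p i, p j))) = signof p * det (transpose_mat B)"
    unfolding eq
    by (subst det_transpose[of _ n], simp, rule det_permute_rows[OF _ p])
       (use B in simp)
  also have "\<dots> = signof p * (signof p * det A)"
    using det_transpose[OF B] det_permute_rows[OF A p] by (simp add: B_def)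
  also have "\<dots> = det A"
    by (simp add: sign_def)
  finally show ?thesis .
qed

lemma tdet_eq:
  assumes "distinct vs" "set vs = pverts T"
  shows "tdet T = det (skew_adj_mat T vs)"
proof -
  define ws where "ws = (SOME ws. distinct ws \<and> set ws = pverts T)"
  have ws: "distinct ws \<and> set ws = pverts T"
    unfolding ws_def by (rule someI[of _ vs]) (use assms in simp)
  then have "mset ws = mset vs"
    using assms by (simp add: set_eq_iff_mset_eq_distinct[symmetric])
  then obtain p where p: "p permutes {..<length vs}" "permute_list p vs = ws"
    by (rule mset_eq_permutation)
  have p': "p permutes {0..<length vs}"
    using p(1) by (simp add: atLeast0LessThan)
  have nth: "ws ! i = vs ! p i" if "i < length vs" for i
    using permute_list_nth[OF p(1) that] p(2) by simp
  have pl: "i < length vs \<Longrightarrow> p i < length vs" for i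
    using permutes_in_image[OF p(1), of i] by simp
  have len: "length ws = length vs"
    using p(2) by auto
  have "skew_adj_mat T ws
      = mat (length vs) (length vs) (\<lambda>(i, j). skew_adj_mat T vs $$ (p i, p j))"
    by (rule eq_matI) (auto simp: skew_adj_mat_def len nth pl)
  moreover have "skew_adj_mat T vs \<in> carrier_mat (length vs) (length vs)"
    by (simp add: skew_adj_mat_def)
  ultimately have "det (skew_adj_mat T ws) = det (skew_adj_mat T vs)"
    using det_permute_rows_cols[OF _ p'] by metis
  then show ?thesis
    by (simp add: tdet_def ws_def)
qed

text \<open>The guard \<open>k \<ge> 1\<close> makes the class for \<open>k = -1\<close> empty.\<close>

definition D_class :: "int \<Rightarrow> 'a pair_pre_digraph set" where
  "D_class k = {T. k \<ge> 1 \<and> tournament T \<and>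
     (\<forall>H :: 'a pair_pre_digraph.
        induced_subgraph (with_proj H) (with_proj T) \<longrightarrow> tdet H \<le> k\<^sup>2)}"

definition transitive_blowup ::
    "'a pair_pre_digraph \<Rightarrow> ('a \<Rightarrow> nat) \<Rightarrow> ('a \<times> nat) pair_pre_digraph" where
  "transitive_blowup T a = \<lparr> pverts = (SIGMA v:pverts T. {1..a v}),
     parcs = {((v, i), (w, j)) | v i w j.
        v \<in> pverts T \<and> w \<in> pverts T \<and> i \<in> {1..a v} \<and> j \<in> {1..a w} \<and>
        ((v, w) \<in> parcs T \<or> v = w \<and> i < j)} \<rparr>"

definition one_transitive_blowups ::
    "'a pair_pre_digraph \<Rightarrow> ('a \<times> nat) pair_pre_digraph set" where
  "one_transitive_blowups T = {transitive_blowup T a | a.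
     \<exists>v\<in>pverts T. a v = 2 \<and> (\<forall>w\<in>pverts T - {v}. a w = 1)}"

definition diamond :: "'a pair_pre_digraph \<Rightarrow> bool" where
  "diamond T \<longleftrightarrow> tournament T \<and>
     (\<exists>a b c d. distinct [a, b, c, d] \<and> pverts T = {a, b, c, d} \<and>
        (a, b) \<in> parcs T \<and> (b, c) \<in> parcs T \<and> (c, a) \<in> parcs T \<and>
        ((\<forall>x\<in>{a, b, c}. (d, x) \<in> parcs T) \<or> (\<forall>x\<in>{a, b, c}. (x, d) \<in> parcs T)))"

definition covertices :: "'a pair_pre_digraph \<Rightarrow> 'a \<Rightarrow> 'a \<Rightarrow> bool" where
  "covertices T u1 u2 \<longleftrightarrow> u1 \<in> pverts T \<and> u2 \<in> pverts T \<and> u1 \<noteq> u2 \<and>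
     (card (pverts T) = 2 \<or>
      card (pverts T) \<ge> 3 \<and> (\<forall>v\<in>pverts T - {u1, u2}. theta T u1 v = theta T u2 v))"

definition revertices :: "'a pair_pre_digraph \<Rightarrow> 'a \<Rightarrow> 'a \<Rightarrow> bool" where
  "revertices T u1 u2 \<longleftrightarrow> u1 \<in> pverts T \<and> u2 \<in> pverts T \<and> u1 \<noteq> u2 \<and>
     (card (pverts T) = 2 \<or>
      card (pverts T) \<ge> 3 \<and> (\<forall>v\<in>pverts T - {u1, u2}. theta T u1 v = - theta T u2 v))"

definition CR_associated :: "'a pair_pre_digraph \<Rightarrow> 'a \<Rightarrow> 'a \<Rightarrow> bool" where
  "CR_associated T u1 u2 \<longleftrightarrow> covertices T u1 u2 \<or> revertices T u1 u2"

definition extend_tournament ::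
    "'a pair_pre_digraph \<Rightarrow> 'a \<Rightarrow> ('a \<Rightarrow> int) \<Rightarrow> 'a pair_pre_digraph" where
  "extend_tournament T u \<sigma> = \<lparr> pverts = insert u (pverts T),
     parcs = parcs T \<union> {(u, w) | w. w \<in> pverts T \<and> \<sigma> w = 1}
                     \<union> {(w, u) | w. w \<in> pverts T \<and> \<sigma> w \<noteq> 1} \<rparr>"

definition CR_vertex :: "'a pair_pre_digraph \<Rightarrow> 'a \<Rightarrow> ('a \<Rightarrow> int) \<Rightarrow> bool" where
  "CR_vertex T u \<sigma> \<longleftrightarrow> (\<exists>w\<in>pverts T. CR_associated (extend_tournament T u \<sigma>) u w)"

text \<open>
  The new vertex \<open>u\<close> ranges over the vertex type, so the condition would be vacuous over a
  finite type whose elements are all used up; the sort \<open>infinite\<close> excludes this.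
  The odd \<open>k\<close> with \<open>T \<in> D_class k - D_class (k - 2)\<close> is unique, as \<open>D_class\<close> is increasing.
\<close>

definition CR_tournament :: "'a :: infinite pair_pre_digraph \<Rightarrow> bool" where
  "CR_tournament T \<longleftrightarrow> (\<exists>k :: int. odd k \<and> T \<in> D_class k - D_class (k - 2) \<and>
     (card (pverts T) = 1 \<or> card (pverts T) = 2 \<or> diamond T \<or>
      (\<forall>u \<sigma>. u \<notin> pverts T \<longrightarrow> \<sigma> \<in> pverts T \<rightarrow> {1, - 1} \<longrightarrow> \<not> CR_vertex T u \<sigma> \<longrightarrow>
         extend_tournament T u \<sigma> \<notin> D_class k)))"

definition strong_CR_tournament :: "'a :: infinite pair_pre_digraph \<Rightarrow> bool" where
  "strong_CR_tournament T \<longleftrightarrow>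
     CR_tournament T \<and> (\<forall>B\<in>one_transitive_blowups T. CR_tournament B)"

definition basic_tournament :: "'a pair_pre_digraph \<Rightarrow> bool" where
  "basic_tournament T \<longleftrightarrow> tournament T \<and> card (pverts T) \<ge> 4 \<and>
     (\<forall>u\<in>pverts T. \<forall>v\<in>pverts T. u \<noteq> v \<longrightarrow> \<not> CR_associated T u v)"

end

theory Submission
  imports Defs
begin

text \<open>
  Put \<open>N = n - 1\<close>. The vertices \<open>1, \<dots>, N\<close> form a transitive path, and pivoting on consecutive
  pairs of path vertices turns the determinant of any even subtournament with at most two
  vertices off the path into the square of an explicit alternating sum. This gives
  \<open>det L_n = N\<^sup>2\<close>, and the bound \<open>(m - 1)\<^sup>2\<close> for its subtournaments on \<open>m\<close> vertices.

  Let \<open>u\<close> be a new vertex and \<open>\<tau> p = (-1)\<^sup>p \<theta>(u, p)\<close>, with \<open>t = \<Sum> \<tau> p > 0\<close> after a change of sign. The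
  square root \<open>Y w\<close> of the determinant of the extension without \<open>w\<close> satisfies \<open>Y (w + 1) - Y w = 2 t - N (\<tau> w + \<tau> (w + 1))\<close>
  cyclically. If all \<open>\<bar>Y w\<bar> \<le> N\<close>, no two cyclically consecutive signs are negative, and if
  some sign is negative, no three consecutive ones are positive. For \<open>t = 1\<close> the signs then
  alternate up to one repetition; in this case, and if no sign is negative, \<open>u\<close> is a CR vertex. For \<open>t \<ge> 3\<close> take two
  successive repetitions \<open>i, i + 1\<close> and \<open>l, l + 1\<close>: the subtournaments without \<open>{i, i + 1, l}\<close> and
  without \<open>{i + 1, l, l + 1}\<close> cannot both have determinant at most \<open>N\<^sup>2\<close>.

  In a 1-transitive blowup of \<open>v\<close>, pivoting on \<open>v\<close> and its twin adds \<open>0\<close> or \<open>\<plusminus>2\<close> times the row of \<open>v\<close>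
  to that of \<open>u\<close>. As the square root is linear in the row of \<open>u\<close>, the case \<open>\<plusminus>2\<close> gives too large a
  determinant unless \<open>u\<close> is a CR vertex.
\<close>

section \<open>Determinants of skew-symmetric forms\<close>

definition form_mat :: "('a \<Rightarrow> 'a \<Rightarrow> int) \<Rightarrow> 'a list \<Rightarrow> int mat" where
  "form_mat S vs = mat (length vs) (length vs) (\<lambda>(i, j). S (vs ! i) (vs ! j))"

text \<open>Arbitrary integer forms are allowed, because a pivot can produce entries outside {-1, 0,
  1}. Indexing by a set turns subtournaments into subsets for one fixed form.\<close>

definition form_det :: "('a \<Rightarrow> 'a \<Rightarrow> int) \<Rightarrow> 'a set \<Rightarrow> int" where
  "form_det S A = det (form_mat S (SOME vs. distinct vs \<and> set vs = A))"

lemma form_mat_carrier: "form_mat S vs \<in> carrier_mat (length vs) (length vs)"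
  by (simp add: form_mat_def)

lemma form_det_eq:
  assumes "distinct vs" "set vs = A"
  shows "form_det S A = det (form_mat S vs)"
proof -
  define ws where "ws = (SOME ws. distinct ws \<and> set ws = A)"
  have ws: "distinct ws \<and> set ws = A"
    unfolding ws_def by (rule someI[of _ vs]) (use assms in simp)
  then have "mset ws = mset vs"
    using assms by (simp add: set_eq_iff_mset_eq_distinct[symmetric])
  then obtain p where p: "p permutes {..<length vs}" "permute_list p vs = ws"
    by (rule mset_eq_permutation)
  have p': "p permutes {0..<length vs}"
    using p(1) by (simp add: atLeast0LessThan)
  have nth: "ws ! i = vs ! p i" if "i < length vs" for i
    using permute_list_nth[OF p(1) that] p(2) by simp
  have pl: "i < length vs \<Longrightarrow> p i < length vs" for i
    using permutes_in_image[OF p(1), of i] by simp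
  have len: "length ws = length vs"
    using p(2) by auto
  have "form_mat S ws = mat (length vs) (length vs) (\<lambda>(i, j). form_mat S vs $$ (p i, p j))"
    by (rule eq_matI) (auto simp: form_mat_def len nth pl)
  then have "det (form_mat S ws) = det (form_mat S vs)"
    using det_permute_rows_cols[OF form_mat_carrier p'] by metis
  then show ?thesis
    by (simp add: form_det_def ws_def)
qed

lemma form_det_cong:
  assumes "finite A" "\<And>x y. x \<in> A \<Longrightarrow> y \<in> A \<Longrightarrow> S x y = S' x y"
  shows "form_det S A = form_det S' A"
proof -
  obtain vs where vs: "distinct vs" "set vs = A"
    using finite_distinct_list[OF assms(1)] by metis
  have "form_mat S vs = form_mat S' vs"
    by (rule eq_matI) (use vs assms(2) in \<open>auto simp: form_mat_def\<close>)
  then show ?thesis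
    using form_det_eq[OF vs] by simp
qed

lemma form_det_image:
  assumes "finite A" "inj_on f A"
  shows "form_det S (f ` A) = form_det (\<lambda>x y. S (f x) (f y)) A"
proof -
  obtain vs where vs: "distinct vs" "set vs = A"
    using finite_distinct_list[OF assms(1)] by metis
  have d: "distinct (map f vs)" "set (map f vs) = f ` A"
    using vs assms(2) by (auto simp: distinct_map)
  have "form_mat S (map f vs) = form_mat (\<lambda>x y. S (f x) (f y)) vs"
    by (rule eq_matI) (auto simp: form_mat_def)
  then show ?thesis
    using form_det_eq[OF vs] form_det_eq[OF d] by simp
qed

definition skew :: "('a \<Rightarrow> 'a \<Rightarrow> int) \<Rightarrow> bool" where
  "skew S \<longleftrightarrow> (\<forall>x y. S x y = - S y x)"

lemma skewD: "skew S \<Longrightarrow> S x y = - S y x"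
  unfolding skew_def by blast

lemma skew_self: "skew S \<Longrightarrow> S x x = 0"
  using skewD[of S x x] by simp

text \<open>Transposition negates the matrix, and negating an odd number of rows negates the
  determinant.\<close>

lemma form_det_odd:
  assumes "skew S" "odd (card A)"
  shows "form_det S A = 0"
proof -
  have "finite A"
    using assms(2) by (metis card.infinite even_zero)
  then obtain vs where vs: "distinct vs" "set vs = A"
    using finite_distinct_list by metis
  have len: "odd (length vs)"
    using vs assms(2) distinct_card by metis
  let ?M = "form_mat S vs"
  have "transpose_mat ?M = (- 1) \<cdot>\<^sub>m ?M"
    by (rule eq_matI) (auto simp: form_mat_def intro: skewD[OF assms(1)])
  then have "det ?M = det ((- 1) \<cdot>\<^sub>m ?M)"
    using det_transpose[OF form_mat_carrier[of S vs]] by simp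
  also have "\<dots> = - det ?M"
    using len by (simp add: form_mat_def)
  finally show ?thesis
    using form_det_eq[OF vs] by simp
qed

lemma form_det_empty: "form_det S {} = 1"
  using form_det_eq[of "[]" "{}" S] by (simp add: form_mat_def)

section \<open>Pivoting on two vertices\<close>

lemma sum_upto_2: "(\<Sum>i = 0..<(2::nat). f i) = f 0 + (f 1 :: int)"
  by (simp add: numeral_2_eq_2)

lemma det_2:
  fixes A :: "'b :: idom mat"
  assumes "A \<in> carrier_mat 2 2"
  shows "det A = A $$ (0, 0) * A $$ (1, 1) - A $$ (0, 1) * A $$ (1, 0)"
proof -
  define E where "E i j = mat 1 1 (\<lambda>_. A $$ (i, j))" for i j
  have "A = four_block_mat (E 0 0) (E 0 1) (E 1 0) (E 1 1)"
    by (rule eq_matI) (use assms in \<open>auto simp: E_def less_Suc_eq\<close>)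
  moreover have "det (four_block_mat (E 0 0) (E 0 1) (E 1 0) (E 1 1)) = det (E 0 0 * E 1 1 - E 0 1 * E 1 0)"
    by (rule det_four_block_mat[where n=1]) (auto simp: E_def scalar_prod_def intro!: eq_matI)
  moreover have "\<dots> = A $$ (0, 0) * A $$ (1, 1) - A $$ (0, 1) * A $$ (1, 0)"
    by (subst det_single) (auto simp: E_def scalar_prod_def)
  ultimately show ?thesis by simp
qed

text \<open>Schur complement of the block on \<open>x\<close> and \<open>y\<close>, which has rows
  (0, 1) and (-1, 0) and determinant 1.\<close>

lemma form_det_pivot:
  assumes sk: "skew S" and fin: "finite A" and xy: "x \<noteq> y" "x \<notin> A" "y \<notin> A" and one: "S x y = 1"
  shows "form_det S (insert x (insert y A))
       = form_det (\<lambda>p q. S p q + S p x * S y q - S p y * S x q) A"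
proof -
  obtain vs where vs: "distinct vs" "set vs = A"
    using finite_distinct_list[OF fin] by metis
  define m where "m = length vs"
  have d: "distinct (x # y # vs)" "set (x # y # vs) = insert x (insert y A)"
    using vs xy by auto
  have yx: "S y x = - 1"
    using skewD[OF sk, of y x] one by simp
  have diag: "S x x = 0" "S y y = 0"
    using skew_self[OF sk] by auto
  define J where "J = mat 2 2 (\<lambda>(i, j). S ([x, y] ! i) ([x, y] ! j))"
  define B where "B = mat 2 m (\<lambda>(i, j). S ([x, y] ! i) (vs ! j))"
  define C where "C = mat m 2 (\<lambda>(i, j). S (vs ! i) ([x, y] ! j))"
  define E where "E = form_mat S vs"
  \<comment> \<open>\<open>F\<close> is \<open>- J^-1 B\<close>, so multiplication by the unipotent
    \<open>P\<close> below clears \<open>B\<close> and turns \<open>E\<close> into the Schur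
    complement.\<close>
  define F where "F = mat 2 m (\<lambda>(i, j). if i = 0 then S y (vs ! j) else - S x (vs ! j))"
  let ?S' = "\<lambda>p q. S p q + S p x * S y q - S p y * S x q"
  have car: "J \<in> carrier_mat 2 2" "B \<in> carrier_mat 2 m" "C \<in> carrier_mat m 2"
      "E \<in> carrier_mat m m" "F \<in> carrier_mat 2 m"
    by (auto simp: J_def B_def C_def E_def F_def form_mat_def m_def)
  have M: "form_mat S (x # y # vs) = four_block_mat J B C E"
    by (rule eq_matI) (auto simp: form_mat_def J_def B_def C_def E_def m_def nth_Cons' numeral_2_eq_2)
  have detJ: "det J = 1"
  proof -
    have "det J = J $$ (0,0) * J $$ (1,1) - J $$ (0,1) * J $$ (1,0)"
      by (rule det_2[OF car(1)])
    then show ?thesis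
      by (simp add: J_def diag one yx)
  qed
  define P where "P = four_block_mat (1\<^sub>m 2) F (0\<^sub>m m 2) (1\<^sub>m m)"
  have detP: "det P = 1"
    unfolding P_def by (subst det_four_block_mat_lower_left_zero[where n=2 and m=m]) (use car in auto)
  have JF: "J * F + B = 0\<^sub>m 2 m"
    by (rule eq_matI) (auto simp: J_def F_def B_def scalar_prod_def sum_upto_2 diag one yx less_2_cases_iff)
  have CF: "C * F + E = form_mat ?S' vs"
    by (rule eq_matI) (auto simp: C_def F_def E_def form_mat_def m_def scalar_prod_def sum_upto_2)
  have "four_block_mat J B C E * P = four_block_mat J (0\<^sub>m 2 m) C (form_mat ?S' vs)"
    unfolding P_def
    by (subst mult_four_block_mat[where ?nr1.0=2 and ?n1.0=2 and ?n2.0=m and ?nr2.0=m and ?nc1.0=2 and ?nc2.0=m])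
       (use car JF CF in auto)
  moreover have "det (four_block_mat J (0\<^sub>m 2 m) C (form_mat ?S' vs)) = det J * det (form_mat ?S' vs)"
    by (rule det_four_block_mat_upper_right_zero[where n=2 and m=m])
       (use car in \<open>auto simp: m_def form_mat_def\<close>)
  moreover have "det (four_block_mat J B C E * P) = det (four_block_mat J B C E) * det P"
    by (rule det_mult[where n="2 + m"]) (use car in \<open>auto simp: P_def\<close>)
  ultimately have "det (four_block_mat J B C E) = det (form_mat ?S' vs)"
    using detJ detP by simp
  then show ?thesis
    using form_det_eq[OF d] form_det_eq[OF vs] M by simp
qed

lemma form_det_pair:
  assumes sk: "skew S" and "x \<noteq> y"
  shows "form_det S {x, y} = (S x y)\<^sup>2"
proof -
  have "form_det S {x, y} = det (form_mat S [x, y])"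
    by (rule form_det_eq) (use assms in auto)
  also have "\<dots> = (S x y)\<^sup>2"
    by (subst det_2) (auto simp: form_mat_def skew_self[OF sk] power2_eq_square skewD[OF sk, of y x])
  finally show ?thesis .
qed

lemma skew_pivot:
  assumes "skew S"
  shows "skew (\<lambda>p q. S p q + S p x * S y q - S p y * S x q)"
  unfolding skew_def
proof (intro allI)
  fix p q
  show "S p q + S p x * S y q - S p y * S x q = - (S q p + S q x * S y p - S q y * S x p)"
    using skewD[OF assms, of q p] skewD[OF assms, of q x] skewD[OF assms, of q y]
      skewD[OF assms, of x p] skewD[OF assms, of y p]
    by (simp add: algebra_simps)
qed

section \<open>Alternating sums and wedges along a list\<close>

text \<open>\<open>alt_wedge a b\<close> sums \<open>(-1)\<^sup>i\<^sup>+\<^sup>j (a x\<^sub>i * b x\<^sub>j - a x\<^sub>j * b x\<^sub>i)\<close> over \<open>i < j\<close>.\<close>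

fun alt_sum :: "('a \<Rightarrow> int) \<Rightarrow> 'a list \<Rightarrow> int" where
  "alt_sum f [] = 0"
| "alt_sum f (x # xs) = f x - alt_sum f xs"

fun alt_wedge :: "('a \<Rightarrow> int) \<Rightarrow> ('a \<Rightarrow> int) \<Rightarrow> 'a list \<Rightarrow> int" where
  "alt_wedge a b [] = 0"
| "alt_wedge a b (x # xs) = b x * alt_sum a xs - a x * alt_sum b xs + alt_wedge a b xs"

lemma alt_sum_cong:
  "(\<And>x. x \<in> set xs \<Longrightarrow> f x = g x) \<Longrightarrow> alt_sum f xs = alt_sum g xs"
  by (induction xs) auto

lemma alt_wedge_cong:
  "(\<And>x. x \<in> set xs \<Longrightarrow> a x = a' x) \<Longrightarrow> (\<And>x. x \<in> set xs \<Longrightarrow> b x = b' x) \<Longrightarrow>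
   alt_wedge a b xs = alt_wedge a' b' xs"
proof (induction xs)
  case (Cons x xs)
  then show ?case
    using alt_sum_cong[of xs a a'] alt_sum_cong[of xs b b'] by simp
qed simp

lemma alt_sum_shift:
  "alt_sum (\<lambda>x. f x + c) xs = alt_sum f xs + (if even (length xs) then 0 else c)"
  by (induction xs) auto

text \<open>By bilinearity and antisymmetry only the wedge with the constant row 1 matters, which
  over a list of even length is the alternating sum. Such shifts are the effect of a pivot on the
  rows of two outside vertices.\<close>

lemma alt_wedge_shift:
  "even (length xs) \<Longrightarrow>
   alt_wedge (\<lambda>x. a x + c) (\<lambda>x. b x + d) xs = alt_wedge a b xs + c * alt_sum b xs - d * alt_sum a xs"
proof (induction xs rule: induct_list012)
  case (3 x y xs)
  then have IH: "alt_wedge (\<lambda>x. a x + c) (\<lambda>x. b x + d) xs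
      = alt_wedge a b xs + c * alt_sum b xs - d * alt_sum a xs" and e: "even (length xs)"
    by auto
  show ?case
    unfolding alt_wedge.simps alt_sum.simps alt_sum_shift IH using e by (simp add: algebra_simps)
qed auto

lemma alt_sum_append:
  "alt_sum f (xs @ ys) = alt_sum f xs + (- 1) ^ length xs * alt_sum f ys"
  by (induction xs) (auto simp: algebra_simps)

lemma alt_wedge_append:
  "alt_wedge a b (xs @ ys) = alt_wedge a b xs + alt_wedge a b ys
     + (- 1) ^ length xs * (alt_sum a xs * alt_sum b ys - alt_sum b xs * alt_sum a ys)"
  by (induction xs) (auto simp: algebra_simps alt_sum_append)

lemma alt_sum_lin: "alt_sum (\<lambda>x. c * f x + d * g x) xs = c * alt_sum f xs + d * alt_sum g xs"
  by (induction xs) (auto simp: algebra_simps)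

lemma alt_wedge_lin:
  "alt_wedge a (\<lambda>x. c * f x + d * g x) xs = c * alt_wedge a f xs + d * alt_wedge a g xs"
  by (induction xs) (auto simp: algebra_simps alt_sum_lin)

lemma abs_alt_sum_le:
  "(\<And>x. x \<in> set xs \<Longrightarrow> \<bar>f x\<bar> \<le> 1) \<Longrightarrow> \<bar>alt_sum f xs\<bar> \<le> int (length xs)"
proof (induction xs)
  case (Cons x xs)
  then have "\<bar>alt_sum f xs\<bar> \<le> int (length xs)" "\<bar>f x\<bar> \<le> 1"
    by auto
  then show ?case
    by simp
qed simp

section \<open>Transitive chains with at most two further vertices\<close>

definition chain :: "('a \<Rightarrow> 'a \<Rightarrow> int) \<Rightarrow> 'a list \<Rightarrow> bool" where
  "chain S xs \<longleftrightarrow> distinct xs \<and> sorted_wrt (\<lambda>x y. S x y = 1) xs"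

text \<open>Both \<open>x\<close> and \<open>y\<close> dominate every later \<open>q\<close>, so the
  pivot correction at \<open>z\<close>, \<open>q\<close> is \<open>S z x - S z y\<close>, constant
  in \<open>q\<close>. It vanishes when \<open>z\<close> lies in \<open>xs\<close>.\<close>

lemma chain_pivot:
  assumes "skew S" "chain S (x # y # xs)"
  defines "S' \<equiv> \<lambda>p q. S p q + S p x * S y q - S p y * S x q"
  shows "chain S' xs" "\<And>z q. q \<in> set xs \<Longrightarrow> S' z q = S z q + (S z x - S z y)"
proof -
  have one: "S x q = 1" "S y q = 1" "S q x = - 1" "S q y = - 1" if "q \<in> set xs" for q
    using assms(2) that skewD[OF assms(1), of q x] skewD[OF assms(1), of q y] by (auto simp: chain_def)
  show "S' z q = S z q + (S z x - S z y)" if "q \<in> set xs" for z q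
    using one[OF that] by (simp add: S'_def)
  then have "S' p q = S p q" if "p \<in> set xs" "q \<in> set xs" for p q
    using one(3,4)[of p] that by simp
  moreover have "sorted_wrt (\<lambda>x y. S x y = 1) xs" "distinct xs"
    using assms(2) by (auto simp: chain_def)
  ultimately show "chain S' xs"
    unfolding chain_def by (metis (mono_tags, lifting) sorted_wrt_mono_rel)
qed

lemma form_det_chain:
  assumes "skew S" "chain S xs" "even (length xs)"
  shows "form_det S (set xs) = 1"
  using assms
proof (induction xs arbitrary: S rule: induct_list012)
  case 1
  then show ?case by (simp add: form_det_empty)
next
  case (3 x y xs)
  let ?S' = "\<lambda>p q. S p q + S p x * S y q - S p y * S x q"
  have "form_det S (set (x # y # xs)) = form_det ?S' (set xs)"
    using 3(3-) form_det_pivot[of S "set xs" x y] by (auto simp: chain_def)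
  also have "\<dots> = 1"
    using 3 skew_pivot[of S x y] chain_pivot(1)[of S x y xs] by simp
  finally show ?case .
qed auto

text \<open>The pivot on \<open>x\<close> and \<open>y\<close> shifts the row of \<open>b\<close> by
  \<open>S b x - S b y\<close>. Over the remaining list of odd length this shift restores exactly
  the two missing terms of the alternating sum.\<close>

lemma form_det_chain_insert:
  assumes "skew S" "chain S xs" "odd (length xs)" "b \<notin> set xs"
  shows "form_det S (insert b (set xs)) = (alt_sum (S b) xs)\<^sup>2"
  using assms
proof (induction xs arbitrary: S rule: induct_list012)
  case (2 x)
  then show ?case by (simp add: form_det_pair)
next
  case (3 x y xs)
  let ?S' = "\<lambda>p q. S p q + S p x * S y q - S p y * S x q"
  have "form_det S (insert b (set (x # y # xs))) = form_det S (insert x (insert y (insert b (set xs))))"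
    by (simp add: insert_commute)
  also have "\<dots> = form_det ?S' (insert b (set xs))"
    using 3(3-) by (intro form_det_pivot) (auto simp: chain_def)
  also have "\<dots> = (alt_sum (?S' b) xs)\<^sup>2"
    using 3 skew_pivot[of S x y] chain_pivot(1)[of S x y xs] by simp
  also have "alt_sum (?S' b) xs = alt_sum (\<lambda>q. S b q + (S b x - S b y)) xs"
    by (rule alt_sum_cong) (use 3 chain_pivot(2)[of S x y xs] in blast)
  also have "\<dots> = alt_sum (S b) (x # y # xs)"
    using 3(5) by (simp add: alt_sum_shift)
  finally show ?case .
qed auto

text \<open>The pivot changes \<open>S a b\<close> by the wedge term of the pair \<open>x\<close>,
  \<open>y\<close>; the constant shifts of the two rows supply the terms that pair \<open>x\<close>
  or \<open>y\<close> with later vertices.\<close>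

lemma form_det_chain_insert2:
  assumes "skew S" "chain S xs" "even (length xs)" "a \<notin> set xs" "b \<notin> set xs" "a \<noteq> b"
  shows "form_det S (insert a (insert b (set xs))) = (S a b + alt_wedge (S a) (S b) xs)\<^sup>2"
  using assms
proof (induction xs arbitrary: S rule: induct_list012)
  case 1
  then show ?case by (simp add: form_det_pair)
next
  case (3 x y xs)
  let ?S' = "\<lambda>p q. S p q + S p x * S y q - S p y * S x q"
  have sh: "?S' z q = S z q + (S z x - S z y)" if "q \<in> set xs" for z q
    using chain_pivot(2)[OF 3(3,4)] that by blast
  have "form_det S (insert a (insert b (set (x # y # xs))))
      = form_det S (insert x (insert y (insert a (insert b (set xs)))))"
    by (simp add: insert_commute)
  also have "\<dots> = form_det ?S' (insert a (insert b (set xs)))"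
    using 3(3-) by (intro form_det_pivot) (auto simp: chain_def)
  also have "\<dots> = (?S' a b + alt_wedge (?S' a) (?S' b) xs)\<^sup>2"
    using 3(5-) skew_pivot[OF 3(3), of x y] chain_pivot(1)[OF 3(3,4)] by (intro 3(1)) auto
  also have "alt_wedge (?S' a) (?S' b) xs
     = alt_wedge (\<lambda>q. S a q + (S a x - S a y)) (\<lambda>q. S b q + (S b x - S b y)) xs"
    by (rule alt_wedge_cong) (use sh in blast)+
  also have "?S' a b + \<dots> = S a b + alt_wedge (S a) (S b) (x # y # xs)"
    using 3(5) skewD[OF 3(3), of x b] skewD[OF 3(3), of y b]
    by (subst alt_wedge_shift) (simp_all add: algebra_simps)
  finally show ?case .
qed auto

section \<open>Cyclic sign sequences\<close>

text \<open>Positions are read cyclically because the recurrence for \<open>Y\<close> also holds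
  from \<open>N\<close> back to \<open>1\<close>.\<close>

definition cyc_suc :: "nat \<Rightarrow> nat \<Rightarrow> nat" where
  "cyc_suc N i = (if i = N then 1 else Suc i)"

lemma bij_cyc_suc: "1 \<le> N \<Longrightarrow> bij_betw (cyc_suc N) {1..N} {1..N}"
proof (rule bij_betw_imageI)
  assume N: "1 \<le> N"
  show "inj_on (cyc_suc N) {1..N}"
    by (auto simp: inj_on_def cyc_suc_def split: if_splits)
  show "cyc_suc N ` {1..N} = {1..N}"
  proof (rule subset_antisym; rule subsetI)
    fix p assume p: "p \<in> {1..N}"
    show "p \<in> cyc_suc N ` {1..N}"
    proof (cases "p = 1")
      case True
      then show ?thesis using N by (auto simp: cyc_suc_def intro!: image_eqI[of _ _ N])
    next
      case False
      then show ?thesis using p by (auto simp: cyc_suc_def intro!: image_eqI[of _ _ "p - 1"])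
    qed
  qed (use N in \<open>auto simp: cyc_suc_def\<close>)
qed

lemma sum_cyc_suc: "1 \<le> N \<Longrightarrow> (\<Sum>i=1..N. f (cyc_suc N i)) = (\<Sum>i=1..N. f i)"
  by (rule sum.reindex_bij_betw[OF bij_cyc_suc])

text \<open>Two successive repetitions \<open>i, i + 1\<close> and \<open>l, l + 1\<close> enclose
  an alternating stretch, on which \<open>Y\<close> grows by \<open>2 * t\<close> per step. This is
  incompatible with \<open>del1\<close> and \<open>del2\<close>, which bound \<open>Y l\<close> from
  above and \<open>Y (Suc i)\<close> from below.\<close>

lemma sign_sequence_long_run:
  fixes \<tau> Y :: "nat \<Rightarrow> int" and t :: int
  assumes N: "odd N"
    and sgn: "\<And>p. p \<in> {1..N} \<Longrightarrow> \<tau> p = 1 \<or> \<tau> p = - 1"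
    and t: "t = (\<Sum>p=1..N. \<tau> p)" "3 * t \<le> int N" "3 \<le> t" "odd t"
    and bound: "\<And>w. w \<in> {1..N} \<Longrightarrow> \<bar>Y w\<bar> \<le> int N"
    and step: "\<And>w. 1 \<le> w \<Longrightarrow> w < N \<Longrightarrow> Y (Suc w) = Y w + 2 * t - int N * (\<tau> w + \<tau> (Suc w))"
    and nomm: "\<And>i. 1 \<le> i \<Longrightarrow> i < N \<Longrightarrow> \<tau> i = 1 \<or> \<tau> (Suc i) = 1"
    and noppp: "\<And>i. 1 \<le> i \<Longrightarrow> Suc i < N \<Longrightarrow> \<tau> i = - 1 \<or> \<tau> (Suc i) = - 1 \<or> \<tau> (Suc (Suc i)) = - 1"
    and del1: "\<And>i l. 1 \<le> i \<Longrightarrow> i + 1 < l \<Longrightarrow> l < N \<Longrightarrow> \<tau> i = 1 \<Longrightarrow> \<tau> (Suc i) = 1 \<Longrightarrow>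
        \<tau> l = 1 \<Longrightarrow> \<tau> (Suc l) = 1 \<Longrightarrow>
        \<bar>Y l - 2 * (t - 3) + 4 * (\<Sum>p=i+2..<l. \<tau> p) - 4 * (int l - int i) + 2 + 2 * int N\<bar> \<le> int N"
    and del2: "\<And>i l. 1 \<le> i \<Longrightarrow> i + 1 < l \<Longrightarrow> l < N \<Longrightarrow> \<tau> i = 1 \<Longrightarrow> \<tau> (Suc i) = 1 \<Longrightarrow>
        \<tau> l = 1 \<Longrightarrow> \<tau> (Suc l) = 1 \<Longrightarrow>
        \<bar>Y (Suc i) + 2 * (t - 3) - 4 * (\<Sum>p=i+2..<l. \<tau> p) + 4 * (int l - int i) - 2 - 2 * int N\<bar> \<le> int N"
  shows False
proof -
  define P where "P = {i \<in> {1..<N}. \<tau> i = 1 \<and> \<tau> (Suc i) = 1}"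
  have finP: "finite P" by (simp add: P_def)
  have N1: "1 \<le> N" using N by (cases N) auto
  have "(\<Sum>i=1..<N. \<tau> i + \<tau> (Suc i)) = (\<Sum>i=1..<N. \<tau> i) + (\<Sum>i=1..<N. \<tau> (Suc i))"
    by (simp add: sum.distrib)
  also have "(\<Sum>i=1..<N. \<tau> i) = t - \<tau> N"
    using N1 t(1) by (simp add: sum.last_plus[of 1 N] atLeastLessThanSuc_atLeastAtMost[symmetric])
  also have "(\<Sum>i=1..<N. \<tau> (Suc i)) = t - \<tau> 1"
    using N1 t(1) sum.atLeast_Suc_lessThan_Suc_shift[of \<tau> 1 N] sum.atLeast_Suc_lessThan[of 1 "Suc N" \<tau>]
    by (simp add: atLeastLessThanSuc_atLeastAtMost o_def)
  finally have s1: "(\<Sum>i=1..<N. \<tau> i + \<tau> (Suc i)) = 2 * t - \<tau> N - \<tau> 1" by simp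
  have "(\<Sum>i=1..<N. \<tau> i + \<tau> (Suc i)) = (\<Sum>i\<in>P. 2)"
  proof (rule sum.mono_neutral_cong_right)
    show "\<forall>i\<in>{1..<N} - P. \<tau> i + \<tau> (Suc i) = 0"
    proof
      fix i assume i: "i \<in> {1..<N} - P"
      then show "\<tau> i + \<tau> (Suc i) = 0"
        using nomm[of i] sgn[of i] sgn[of "Suc i"] by (auto simp: P_def)
    qed
  qed (auto simp: P_def)
  moreover have "\<tau> N \<le> 1" "\<tau> 1 \<le> 1"
    using sgn[of N] sgn[of 1] N1 by auto
  \<comment> \<open>Indices in \<open>P\<close> contribute 2 to the sum and the others 0, so
    \<open>2 * card P \<ge> 2 * t - 2 \<ge> 4\<close>. The loss of 2 comes from the pair
    \<open>N\<close>, \<open>1\<close>, which the linear sum omits.\<close>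
  ultimately have cardP: "2 \<le> card P"
    using s1 t(3) by simp
  then have neP: "P \<noteq> {}" by auto
  define i where "i = Min P"
  define l where "l = Min (P - {i})"
  have iP: "i \<in> P" using finP neP by (simp add: i_def)
  have "card (P - {i}) \<ge> 1" using cardP iP finP by simp
  then have ne2: "P - {i} \<noteq> {}" by (metis card.empty not_one_le_zero)
  then have lP: "l \<in> P - {i}" using finP Min_in[of "P - {i}"] by (simp add: l_def)
  have il: "i < l" using lP Min_le[OF finP, of l] by (auto simp: i_def simp del: Min_le)
  have gap: "j \<notin> P" if "i < j" "j < l" for j
    using that Min_le[of "P - {i}" j] finP by (auto simp: l_def simp del: Min_le)
  have i: "1 \<le> i" "\<tau> i = 1" "\<tau> (Suc i) = 1" and l: "l < N" "\<tau> l = 1" "\<tau> (Suc l) = 1"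
    using iP lP by (auto simp: P_def)
  have "l \<noteq> Suc i"
    using noppp[of i] i l by auto
  then have il2: "i + 1 < l" using il by simp
  define b where "b = l - i - 1"
  \<comment> \<open>Strictly between \<open>i\<close> and \<open>l\<close> no index lies in
    \<open>P\<close>, and no two neighbours are both negative; so the signs alternate, starting with
    a plus at \<open>i + 1\<close>.\<close>
  have run: "\<tau> (i + 1 + k) = (- 1) ^ k \<and> Y (i + 1 + k) = Y (i + 1) + 2 * t * int k \<and>
      (k \<ge> 1 \<longrightarrow> (\<Sum>p=i+2..<i+1+k. \<tau> p) = (if even k then - 1 else 0))" if "k \<le> b" for k
    using that
  proof (induction k)
    case 0
    then show ?case using i by simp
  next
    case (Suc k)
    let ?j = "i + 1 + k"
    have j: "i < ?j" "?j < l" using Suc.prems by (auto simp: b_def)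
    have IH: "\<tau> ?j = (- 1) ^ k" "Y ?j = Y (i + 1) + 2 * t * int k"
      "k \<ge> 1 \<Longrightarrow> (\<Sum>p=i+2..<?j. \<tau> p) = (if even k then - 1 else 0)"
      using Suc by auto
    have j1: "1 \<le> ?j" "?j < N" using j l by auto
    have "\<not> (\<tau> ?j = 1 \<and> \<tau> (Suc ?j) = 1)"
      using gap[OF j] j1 by (auto simp: P_def)
    then have alt: "\<tau> (Suc ?j) = - \<tau> ?j"
      using nomm[OF j1] sgn[of ?j] sgn[of "Suc ?j"] j1 by auto
    have "Y (Suc ?j) = Y ?j + 2 * t"
      using step[OF j1] alt by simp
    moreover have "(\<Sum>p=i+2..<Suc ?j. \<tau> p) = (if even (Suc k) then - 1 else 0)"
    proof (cases "k = 0")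
      case False
      then have "(\<Sum>p=i+2..<Suc ?j. \<tau> p) = (\<Sum>p=i+2..<?j. \<tau> p) + \<tau> ?j"
        by (subst sum.atLeastLessThan_Suc) auto
      then show ?thesis
        using IH(1) IH(3) False by simp
    qed simp
    ultimately show ?case
      using IH alt by (simp add: algebra_simps)
  qed
  have lb: "i + 1 + b = l" using il by (simp add: b_def)
  have evb: "even b" using run[of b] lb l by (cases "even b") auto
  have "b \<noteq> 0" "b \<noteq> 1" using il2 lb evb by auto
  then have b2: "2 \<le> b" by simp
  have mid: "(\<Sum>p=i+2..<l. \<tau> p) = - 1"
    using run[of b] lb evb b2 by auto
  have C: "Y l = Y (Suc i) + 2 * t * int b" using run[of b] lb by simp
  have li: "int l - int i = int b + 1" using lb by linarith
  have ineq1: "Y l + 2 * (int N - t) - 4 * int b \<le> int N"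
    using del1[OF i(1) il2 l(1) i(2,3) l(2,3)] mid li by simp
  have ineq2: "- int N \<le> Y (Suc i) - 2 * (int N - t) + 4 * int b"
    using del2[OF i(1) il2 l(1) i(2,3) l(2,3)] mid li by simp
  have "- int N \<le> Y (Suc i)" "Y l \<le> int N"
    using bound[of "Suc i"] bound[of l] il l by auto
  then have win: "t * int b \<le> int N" using C by linarith
  \<comment> \<open>Half the difference of \<open>ineq1\<close> and \<open>ineq2\<close>, with
    \<open>C\<close> substituted.\<close>
  have main: "t * int b + int N - 2 * t - 4 * int b \<le> 0"
    using ineq1 ineq2 C by (simp add: algebra_simps)
  show False
  proof (cases "t = 3")
    case True
    \<comment> \<open>Here \<open>main\<close> reads \<open>N \<le> b + 6\<close> and
      \<open>win\<close> reads \<open>3 * b \<le> N\<close>. For \<open>b = 2\<close> the former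
      contradicts \<open>N \<ge> 9\<close>.\<close>
    then have "int b \<le> 3" using win main by simp
    then have "b = 2" using b2 evb by (cases "b = 3") auto
    then show False using main True t by simp
  next
    case False
    then have "5 \<le> t" using t(3,4) by (cases "t = 4") auto
    \<comment> \<open>This product turns \<open>main\<close> into \<open>N \<le> 8\<close>, against
      \<open>N \<ge> 3 * t \<ge> 15\<close>.\<close>
    then have "0 \<le> (t - 4) * (int b - 2)" using b2 by simp
    then have "int N \<le> 8" using main by (simp add: algebra_simps)
    then show False using t(2) \<open>5 \<le> t\<close> by simp
  qed
qed

text \<open>Summed around the cycle, the neighbouring pairs give 2, and each repeated plus
  contributes 2, every other pair 0. So there is exactly one repetition, and \<open>w\<close> is its
  second member. The formula changes sign below \<open>w\<close> because \<open>N\<close> and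
  \<open>1\<close> are both odd although they are cyclic neighbours.\<close>

lemma sign_sequence_alternating:
  fixes \<tau> :: "nat \<Rightarrow> int"
  assumes N: "odd N"
    and sgn: "\<And>p. p \<in> {1..N} \<Longrightarrow> \<tau> p = 1 \<or> \<tau> p = - 1"
    and t: "(\<Sum>p=1..N. \<tau> p) = 1"
    and nomm: "\<And>i. i \<in> {1..N} \<Longrightarrow> \<tau> i = 1 \<or> \<tau> (cyc_suc N i) = 1"
  shows "\<exists>w\<in>{1..N}. \<forall>p\<in>{1..N}. \<tau> p = (if w \<le> p then (- 1) ^ (p + w) else - ((- 1) ^ (p + w)))"
proof -
  have N1: "1 \<le> N" using N by (cases N) auto
  have cs: "cyc_suc N i \<in> {1..N}" if "i \<in> {1..N}" for i
    using bij_betwE[OF bij_cyc_suc[OF N1]] that by blast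
  define Q where "Q = {i \<in> {1..N}. \<tau> i = 1 \<and> \<tau> (cyc_suc N i) = 1}"
  have "(\<Sum>i=1..N. \<tau> i + \<tau> (cyc_suc N i)) = 2"
    using t sum_cyc_suc[OF N1, of \<tau>] by (simp add: sum.distrib)
  moreover have "(\<Sum>i=1..N. \<tau> i + \<tau> (cyc_suc N i)) = (\<Sum>i\<in>Q. 2)"
  proof (rule sum.mono_neutral_cong_right)
    show "\<forall>i\<in>{1..N} - Q. \<tau> i + \<tau> (cyc_suc N i) = 0"
    proof
      fix i assume i: "i \<in> {1..N} - Q"
      then have "\<tau> i = 1 \<or> \<tau> i = -1" "\<tau> (cyc_suc N i) = 1 \<or> \<tau> (cyc_suc N i) = -1"
        using sgn[of i] sgn[of "cyc_suc N i"] cs[of i] by blast+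
      then show "\<tau> i + \<tau> (cyc_suc N i) = 0"
        using nomm[of i] i by (auto simp: Q_def)
    qed
  qed (auto simp: Q_def)
  ultimately have "card Q = 1" by simp
  then obtain i0 where i0: "Q = {i0}" by (auto simp: card_1_singleton_iff)
  then have i0': "i0 \<in> {1..N}" "\<tau> i0 = 1" "\<tau> (cyc_suc N i0) = 1" by (auto simp: Q_def)
  have alt: "\<tau> (cyc_suc N i) = - \<tau> i" if "i \<in> {1..N}" "i \<noteq> i0" for i
  proof -
    have "i \<notin> Q" using that i0 by simp
    moreover have "\<tau> i = 1 \<or> \<tau> i = -1" "\<tau> (cyc_suc N i) = 1 \<or> \<tau> (cyc_suc N i) = -1"
      using sgn[of i] sgn[of "cyc_suc N i"] cs[of i] that by blast+
    ultimately show ?thesis using nomm[of i] that by (auto simp: Q_def)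
  qed
  define w where "w = cyc_suc N i0"
  have w: "w \<in> {1..N}" "\<tau> w = 1" using cs i0' by (auto simp: w_def)
  have wi: "i0 < w \<or> w = 1 \<and> i0 = N" by (auto simp: w_def cyc_suc_def)
  have wi': "i0 < w \<Longrightarrow> w = Suc i0" using i0' by (auto simp: w_def cyc_suc_def split: if_splits)
  have up: "\<tau> p = (- 1) ^ (p + w)" if "w \<le> p" "p \<le> N" for p
    using that
  proof (induction p rule: dec_induct)
    case base
    then show ?case using w by simp
  next
    case (step p)
    have "p \<noteq> i0" using wi step by auto
    moreover have "p \<in> {1..N}" using w step by auto
    moreover have "cyc_suc N p = Suc p" using step by (simp add: cyc_suc_def)
    ultimately have "\<tau> (Suc p) = - \<tau> p" using alt[of p] by simp
    then show ?case using step by simp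
  qed
  have low: "\<tau> p = - ((- 1) ^ (p + w))" if "1 \<le> p" "p < w" for p
    using that
  proof (induction p rule: dec_induct)
    case base
    have ws: "i0 < w" "w = Suc i0" using base wi wi' by auto
    have "N \<noteq> i0" using ws w by auto
    then have "\<tau> (cyc_suc N N) = - \<tau> N" using alt[of N] N1 by simp
    then have "\<tau> 1 = - ((- 1) ^ (N + w))" using up[of N] w by (simp add: cyc_suc_def)
    then show ?case using N by (simp add: minus_one_power_iff)
  next
    case (step p)
    have ws: "i0 < w" "w = Suc i0" using step wi wi' by auto
    have "p \<noteq> i0" using ws step by auto
    moreover have "p \<in> {1..N}" using w step by auto
    moreover have "cyc_suc N p = Suc p" using step w by (auto simp: cyc_suc_def)
    ultimately have "\<tau> (Suc p) = - \<tau> p" using alt[of p] by simp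
    then show ?case using step by simp
  qed
  show ?thesis
    using w(1) up low by (intro bexI[of _ w]) auto
qed

text \<open>All \<open>Y w\<close> lie in a window of width \<open>2 * N\<close>, while a step
  changes \<open>Y\<close> by \<open>2 * t\<close> over opposite signs and by
  \<open>2 * t - 2 * N\<close> or \<open>2 * t + 2 * N\<close> over equal ones. This restricts the
  sign patterns until only \<open>t = 1\<close> is left besides the constant sequence.\<close>

lemma sign_sequence_classification:
  fixes \<tau> Y :: "nat \<Rightarrow> int" and t :: int
  assumes N: "odd N"
    and sgn: "\<And>p. p \<in> {1..N} \<Longrightarrow> \<tau> p = 1 \<or> \<tau> p = - 1"
    and t: "t = (\<Sum>p=1..N. \<tau> p)" "0 < t"
    and bound: "\<And>w. w \<in> {1..N} \<Longrightarrow> \<bar>Y w\<bar> \<le> int N"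
    and step: "\<And>w. w \<in> {1..N} \<Longrightarrow>
        Y (cyc_suc N w) = Y w + 2 * t - int N * (\<tau> w + \<tau> (cyc_suc N w))"
    and del1: "\<And>i l. 1 \<le> i \<Longrightarrow> i + 1 < l \<Longrightarrow> l < N \<Longrightarrow> \<tau> i = 1 \<Longrightarrow> \<tau> (Suc i) = 1 \<Longrightarrow>
        \<tau> l = 1 \<Longrightarrow> \<tau> (Suc l) = 1 \<Longrightarrow>
        \<bar>Y l - 2 * (t - 3) + 4 * (\<Sum>p=i+2..<l. \<tau> p) - 4 * (int l - int i) + 2 + 2 * int N\<bar> \<le> int N"
    and del2: "\<And>i l. 1 \<le> i \<Longrightarrow> i + 1 < l \<Longrightarrow> l < N \<Longrightarrow> \<tau> i = 1 \<Longrightarrow> \<tau> (Suc i) = 1 \<Longrightarrow>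
        \<tau> l = 1 \<Longrightarrow> \<tau> (Suc l) = 1 \<Longrightarrow>
        \<bar>Y (Suc i) + 2 * (t - 3) - 4 * (\<Sum>p=i+2..<l. \<tau> p) + 4 * (int l - int i) - 2 - 2 * int N\<bar> \<le> int N"
  shows "(\<forall>p\<in>{1..N}. \<tau> p = 1) \<or>
    (\<exists>w\<in>{1..N}. \<forall>p\<in>{1..N}. \<tau> p = (if w \<le> p then (- 1) ^ (p + w) else - ((- 1) ^ (p + w))))"
proof (cases "\<forall>p\<in>{1..N}. \<tau> p = 1")
  case False
  then obtain p0 where p0: "p0 \<in> {1..N}" "\<tau> p0 = - 1" using sgn by blast
  have N1: "1 \<le> N" using N by (cases N) auto
  let ?c = "cyc_suc N"
  have cs: "?c i \<in> {1..N}" if "i \<in> {1..N}" for i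
    using bij_betwE[OF bij_cyc_suc[OF N1]] that by blast
  have nomm: "\<tau> i = 1 \<or> \<tau> (?c i) = 1" if i: "i \<in> {1..N}" for i
  proof (rule ccontr)
    assume "\<not> ?thesis"
    then have "\<tau> i = - 1" "\<tau> (?c i) = - 1" using sgn[OF i] sgn[OF cs[OF i]] by auto
    then have "Y (?c i) = Y i + 2 * t + 2 * int N" using step[OF i] by simp
    then show False using bound[OF i] bound[OF cs[OF i]] t(2) by linarith
  qed
  have oddt: "odd t"
  proof -
    have "even (\<Sum>p=1..N. \<tau> p - 1)" by (rule dvd_sum) (use sgn in force)
    then have "even (t - int N)" using t(1) by (simp add: sum_subtractf)
    then show ?thesis using N by simp
  qed
  \<comment> \<open>A negative sign has positive cyclic neighbours, so \<open>Y\<close> rises by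
    \<open>2 * t\<close> twice and \<open>4 * t \<le> 2 * N\<close>; oddness of \<open>N\<close>
    makes this strict.\<close>
  have small: "2 * t < int N"
  proof -
    obtain i where i: "i \<in> {1..N}" "?c i = p0"
      using bij_betw_imp_surj_on[OF bij_cyc_suc[OF N1]] p0(1) by (metis imageE)
    have "\<tau> i = 1" using nomm[OF i(1)] i(2) p0 by auto
    then have "Y p0 = Y i + 2 * t" using step[OF i(1)] i(2) p0 by simp
    moreover have "\<tau> (?c p0) = 1" using nomm[OF p0(1)] p0 by auto
    then have "Y (?c p0) = Y p0 + 2 * t" using step[OF p0(1)] p0 by simp
    ultimately have "2 * t \<le> int N" using bound[OF i(1)] bound[OF cs[OF p0(1)]] by linarith
    moreover have "2 * t \<noteq> int N" using N by (metis dvd_triv_left even_of_nat)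
    ultimately show ?thesis by simp
  qed
  \<comment> \<open>Three positive signs would lower \<open>Y\<close> by
    \<open>4 * N - 4 * t\<close>, which exceeds \<open>2 * N\<close> by
    \<open>small\<close>.\<close>
  have noppp: "\<tau> i = - 1 \<or> \<tau> (?c i) = - 1 \<or> \<tau> (?c (?c i)) = - 1" if i: "i \<in> {1..N}" for i
  proof (rule ccontr)
    assume "\<not> ?thesis"
    then have "\<tau> i = 1" "\<tau> (?c i) = 1" "\<tau> (?c (?c i)) = 1"
      using sgn[OF i] sgn[OF cs[OF i]] sgn[OF cs[OF cs[OF i]]] by auto
    then have "Y (?c (?c i)) = Y i + 4 * t - 4 * int N"
      using step[OF i] step[OF cs[OF i]] by simp
    then show False using bound[OF i] bound[OF cs[OF cs[OF i]]] small by linarith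
  qed
  \<comment> \<open>Three cyclically consecutive signs are not all positive, so they sum to at most
    1; around the cycle this becomes \<open>3 * t \<le> N\<close>.\<close>
  have "(\<Sum>i=1..N. \<tau> i + \<tau> (?c i)) \<le> (\<Sum>i=1..N. 1 - \<tau> (?c (?c i)))"
  proof (rule sum_mono)
    fix i assume i: "i \<in> {1..N}"
    show "\<tau> i + \<tau> (?c i) \<le> 1 - \<tau> (?c (?c i))"
      using noppp[OF i] nomm[OF i] nomm[OF cs[OF i]] sgn[OF i] sgn[OF cs[OF i]] sgn[OF cs[OF cs[OF i]]]
      by auto
  qed
  then have t3: "3 * t \<le> int N"
    using t(1) sum_cyc_suc[OF N1, of \<tau>] sum_cyc_suc[OF N1, of "\<lambda>i. \<tau> (?c i)"]
    by (simp add: sum.distrib sum_subtractf)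
  have "\<not> 3 \<le> t"
  proof
    assume "3 \<le> t"
    show False
    proof (rule sign_sequence_long_run[OF N sgn t(1) t3 \<open>3 \<le> t\<close> oddt bound])
      show "Y (Suc w) = Y w + 2 * t - int N * (\<tau> w + \<tau> (Suc w))" if "1 \<le> w" "w < N" for w
        using step[of w] that by (simp add: cyc_suc_def)
      show "\<tau> i = 1 \<or> \<tau> (Suc i) = 1" if "1 \<le> i" "i < N" for i
        using nomm[of i] that by (simp add: cyc_suc_def)
      show "\<tau> i = - 1 \<or> \<tau> (Suc i) = - 1 \<or> \<tau> (Suc (Suc i)) = - 1" if "1 \<le> i" "Suc i < N" for i
        using noppp[of i] that by (simp add: cyc_suc_def)
    qed (use del1 del2 in auto)
  qed
  then have "t = 1" using oddt t(2) by (cases "t = 2") auto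
  then show ?thesis
    using sign_sequence_alternating[of N \<tau>] N sgn nomm t(1) by simp
qed blast

section \<open>Determinants in extensions of \<open>L_tournament\<close>\<close>

lemma alt_sum_upt:
  "p \<le> q \<Longrightarrow> alt_sum (\<lambda>i. (- 1) ^ i * f i) [p..<q] = (- 1) ^ p * (\<Sum>i=p..<q. f i)"
proof (induction q rule: dec_induct)
  case (step q)
  have "(- 1 :: int) ^ (q - p) * (- 1) ^ q = (- 1) ^ p"
    using step(1) by (auto simp: minus_one_power_iff)
  then show ?case
    using step by (simp add: alt_sum_append algebra_simps)
qed simp

lemma alt_sum_upt_const:
  "p \<le> q \<Longrightarrow> alt_sum (\<lambda>i. - ((- 1) ^ i)) [p..<q] = - ((- 1) ^ p * (int q - int p))"
  using alt_sum_upt[of p q "\<lambda>_. - 1"] by (simp add: of_nat_diff algebra_simps)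

text \<open>The factors \<open>(- 1) ^ i\<close> cancel the alternation, and a pair
  \<open>i < j\<close> contributes \<open>f i - f j\<close>. Hence \<open>f i\<close> occurs
  \<open>q - 1 - i\<close> times with a plus and \<open>i - p\<close> times with a minus.\<close>

lemma alt_wedge_upt:
  assumes "p \<le> q"
  shows "alt_wedge (\<lambda>i. - ((- 1) ^ i)) (\<lambda>i. (- 1) ^ i * f i) [p..<q]
     = (int p + int q - 1) * (\<Sum>i=p..<q. f i) - 2 * (\<Sum>i=p..<q. int i * f i)"
proof -
  define a b where "a = (\<lambda>i::nat. - ((- 1 :: int) ^ i))" and "b = (\<lambda>i. (- 1) ^ i * f i)"
  have sums: "alt_sum a [p..<q] = - ((- 1) ^ p * (int q - int p))"
    "alt_sum b [p..<q] = (- 1) ^ p * (\<Sum>i=p..<q. f i)" if "p \<le> q" for q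
    using that by (simp_all add: a_def b_def alt_sum_upt alt_sum_upt_const)
  from assms have "alt_wedge a b [p..<q]
     = (int p + int q - 1) * (\<Sum>i=p..<q. f i) - 2 * (\<Sum>i=p..<q. int i * f i)"
  proof (induction q rule: dec_induct)
    case (step q)
    have pw: "(- 1 :: int) ^ (q - p) = (- 1) ^ p * (- 1) ^ q"
      using step(1) by (auto simp: minus_one_power_iff)
    have ab: "a q = - ((- 1) ^ q)" "b q = (- 1) ^ q * f q"
      by (simp_all add: a_def b_def)
    show ?case
      using step by (simp add: alt_wedge_append sums pw ab algebra_simps)
  qed simp
  then show ?thesis
    by (simp add: a_def b_def)
qed

section \<open>The form of L_n and its subdeterminants\<close>

text \<open>The form of \<open>L_tournament (Suc N)\<close> for odd \<open>N\<close>, whose apex is \<open>Suc N\<close>; no condition is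
  imposed on the other vertices.\<close>

definition L_form :: "nat \<Rightarrow> (nat \<Rightarrow> nat \<Rightarrow> int) \<Rightarrow> bool" where
  "L_form N S \<longleftrightarrow> skew S \<and> odd N \<and> 3 \<le> N \<and> (\<forall>i j. 1 \<le> i \<and> i < j \<and> j \<le> N \<longrightarrow> S i j = 1) \<and>
     (\<forall>i\<in>{1..N}. S (Suc N) i = - ((- 1) ^ i))"

lemma L_form_chain:
  assumes "L_form N S" "set xs \<subseteq> {1..N}" "sorted_wrt (<) xs"
  shows "chain S xs"
proof -
  have "sorted_wrt (\<lambda>x y. S x y = 1) xs"
    by (rule sorted_wrt_mono_rel[OF _ assms(3)])
       (use assms(1,2) in \<open>force simp: L_form_def subset_iff\<close>)
  then show ?thesis
    using assms(3) by (auto simp: chain_def strict_sorted_iff)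
qed

text \<open>Without the apex, \<open>A\<close> is transitive and has determinant 1. With it, the
  square root is an alternating sum of \<open>card A - 1 \<le> m\<close> signs.\<close>

lemma L_form_sub_det:
  assumes L: "L_form N S" and A: "A \<subseteq> {1..Suc N}" "even (card A)" "card A \<le> m + 1" and m: "1 \<le> m"
  shows "form_det S A \<le> (int m)\<^sup>2"
proof -
  have fin: "finite A" using A(1) finite_subset by blast
  have sk: "skew S" using L by (simp add: L_form_def)
  define xs where "xs = sorted_list_of_set (A - {Suc N})"
  have sxs: "set xs = A - {Suc N}" "sorted_wrt (<) xs" "length xs = card (A - {Suc N})"
    using fin by (auto simp: xs_def)
  have ch: "chain S xs" by (rule L_form_chain[OF L]) (use sxs A in auto)
  show ?thesis
  proof (cases "Suc N \<in> A")
    case False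
    then have "form_det S A = 1"
      using form_det_chain[OF sk ch] sxs A by simp
    then show ?thesis using m by (simp add: one_le_power)
  next
    case True
    then have card: "length xs = card A - 1" "1 \<le> card A"
      using sxs(3) fin by (auto simp: Suc_le_eq card_gt_0_iff)
    have "odd (length xs)" using card A(2) by simp
    moreover have "A = insert (Suc N) (set xs)" using True sxs by auto
    ultimately have "form_det S A = (alt_sum (S (Suc N)) xs)\<^sup>2"
      using form_det_chain_insert[OF sk ch, of "Suc N"] sxs(1) by simp
    moreover have "\<bar>alt_sum (S (Suc N)) xs\<bar> \<le> int (length xs)"
    proof (rule abs_alt_sum_le)
      fix x assume "x \<in> set xs"
      then have "x \<in> {1..N}" using sxs A by auto
      then show "\<bar>S (Suc N) x\<bar> \<le> 1" using L by (simp add: L_form_def minus_one_power_iff)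
    qed
    then have "\<bar>alt_sum (S (Suc N)) xs\<bar> \<le> \<bar>int m\<bar>" using card A(3) by linarith
    ultimately show ?thesis by (simp only: abs_le_square_iff)
  qed
qed

text \<open>The signs of the apex match the alternation along the whole path, so \<open>N\<close>
  terms equal to 1 are added.\<close>

lemma L_form_det:
  assumes L: "L_form N S"
  shows "form_det S {1..Suc N} = (int N)\<^sup>2"
proof -
  have sk: "skew S" and N: "odd N" "1 \<le> N" using L by (auto simp: L_form_def)
  have ch: "chain S [1..<Suc N]"
      by (rule L_form_chain[OF L]) (auto simp del: upt_Suc)
  have "form_det S {1..Suc N} = form_det S (insert (Suc N) (set [1..<Suc N]))"
    by (rule arg_cong[of _ _ "form_det S"]) auto
  also have "\<dots> = (alt_sum (S (Suc N)) [1..<Suc N])\<^sup>2"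
    by (rule form_det_chain_insert[OF sk ch]) (use N in simp_all)
  also have "alt_sum (S (Suc N)) [1..<Suc N] = alt_sum (\<lambda>i. - ((- 1) ^ i)) [1..<Suc N]"
    by (rule alt_sum_cong) (use L in \<open>auto simp: L_form_def\<close>)
  also have "\<dots> = int N"
    by (subst alt_sum_upt_const) auto
  finally show ?thesis .
qed

text \<open>The determinant of a one-vertex modification of the tournament is the square of a linear
  functional of the new row, since both determinant formulas for chains are.\<close>

lemma L_form_delete_linear:
  assumes L: "L_form N S" and v: "v \<in> {1..Suc N}"
  shows "\<exists>\<phi> :: (nat \<Rightarrow> int) \<Rightarrow> int.
    (\<forall>f g. (\<forall>x\<in>{1..Suc N} - {v}. f x = g x) \<longrightarrow> \<phi> f = \<phi> g) \<and>
    (\<forall>c d f g. \<phi> (\<lambda>x. c * f x + d * g x) = c * \<phi> f + d * \<phi> g) \<and>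
    (\<forall>S' z. skew S' \<longrightarrow> (\<forall>p\<in>{1..Suc N} - {v}. \<forall>q\<in>{1..Suc N} - {v}. S' p q = S p q) \<longrightarrow>
       z \<notin> {1..Suc N} - {v} \<longrightarrow> form_det S' (insert z ({1..Suc N} - {v})) = (\<phi> (S' z))\<^sup>2)"
proof (cases "v = Suc N")
  case True
  show ?thesis
  proof (rule exI[of _ "\<lambda>f. alt_sum f [1..<Suc N]"], intro conjI allI impI)
    fix f g :: "nat \<Rightarrow> int"
    assume "\<forall>x\<in>{1..Suc N} - {v}. f x = g x"
    then show "alt_sum f [1..<Suc N] = alt_sum g [1..<Suc N]"
      using True by (intro alt_sum_cong) auto
  next
    fix c d :: int and f g :: "nat \<Rightarrow> int"
    show "alt_sum (\<lambda>x. c * f x + d * g x) [1..<Suc N]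
        = c * alt_sum f [1..<Suc N] + d * alt_sum g [1..<Suc N]"
      by (rule alt_sum_lin)
  next
    fix S' :: "nat \<Rightarrow> nat \<Rightarrow> int" and z
    assume sk: "skew S'" and eq: "\<forall>p\<in>{1..Suc N} - {v}. \<forall>q\<in>{1..Suc N} - {v}. S' p q = S p q"
      and z: "z \<notin> {1..Suc N} - {v}"
    have "chain S [1..<Suc N]"
      by (rule L_form_chain[OF L]) (auto simp del: upt_Suc)
    moreover have "sorted_wrt (\<lambda>x y. S' x y = 1) [1..<Suc N]" if "sorted_wrt (\<lambda>x y. S x y = 1) [1..<Suc N]"
      by (rule sorted_wrt_mono_rel[OF _ that]) (use eq True in auto)
    ultimately have ch: "chain S' [1..<Suc N]"
      unfolding chain_def by blast
    have set: "set [1..<Suc N] = {1..Suc N} - {v}" using True by auto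
    show "form_det S' (insert z ({1..Suc N} - {v})) = (alt_sum (S' z) [1..<Suc N])\<^sup>2"
      using form_det_chain_insert[OF sk ch, of z] z L unfolding set by (simp add: L_form_def)
  qed
next
  case False
  define xs where "xs = sorted_list_of_set ({1..N} - {v})"
  have set: "set xs = {1..N} - {v}" "sorted_wrt (<) xs" "length xs = N - 1"
    using v False by (auto simp: xs_def)
  have ev: "even (length xs)" using set(3) L by (simp add: L_form_def)
  have ch: "chain S xs" by (rule L_form_chain[OF L]) (use set in auto)
  \<comment> \<open>The apex remains beside an even path of \<open>N - 1\<close> vertices, so the
    two-vertex formula applies to the apex and \<open>z\<close>. As \<open>f\<close> is the row of
    \<open>z\<close>, the entry \<open>S' (Suc N) z\<close> appears as
    \<open>- f (Suc N)\<close>.\<close>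
  show ?thesis
  proof (rule exI[of _ "\<lambda>f. - f (Suc N) + alt_wedge (S (Suc N)) f xs"], intro conjI allI impI)
    fix f g :: "nat \<Rightarrow> int"
    assume eq: "\<forall>x\<in>{1..Suc N} - {v}. f x = g x"
    then have "alt_wedge (S (Suc N)) f xs = alt_wedge (S (Suc N)) g xs"
      using set(1) by (intro alt_wedge_cong) auto
    then show "- f (Suc N) + alt_wedge (S (Suc N)) f xs = - g (Suc N) + alt_wedge (S (Suc N)) g xs"
      using eq False by simp
  next
    fix c d :: int and f g :: "nat \<Rightarrow> int"
    show "- (c * f (Suc N) + d * g (Suc N)) + alt_wedge (S (Suc N)) (\<lambda>x. c * f x + d * g x) xs
      = c * (- f (Suc N) + alt_wedge (S (Suc N)) f xs) + d * (- g (Suc N) + alt_wedge (S (Suc N)) g xs)"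
      by (simp add: alt_wedge_lin algebra_simps)
  next
    fix S' :: "nat \<Rightarrow> nat \<Rightarrow> int" and z
    assume sk: "skew S'" and eq: "\<forall>p\<in>{1..Suc N} - {v}. \<forall>q\<in>{1..Suc N} - {v}. S' p q = S p q"
      and z: "z \<notin> {1..Suc N} - {v}"
    have "sorted_wrt (\<lambda>x y. S' x y = 1) xs"
      by (rule sorted_wrt_mono_rel[of _ "\<lambda>x y. S x y = 1"]) (use eq set ch in \<open>auto simp: chain_def\<close>)
    then have ch': "chain S' xs" using ch by (simp add: chain_def)
    have "insert z ({1..Suc N} - {v}) = insert (Suc N) (insert z (set xs))"
      using set(1) False by (simp add: atLeastAtMostSuc_conv insert_Diff_if insert_commute)
    then have "form_det S' (insert z ({1..Suc N} - {v})) = form_det S' (insert (Suc N) (insert z (set xs)))"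
      by (rule arg_cong)
    also have "\<dots> = (S' (Suc N) z + alt_wedge (S' (Suc N)) (S' z) xs)\<^sup>2"
      using z set(1) False by (intro form_det_chain_insert2[OF sk ch' ev]) auto
    also have "alt_wedge (S' (Suc N)) (S' z) xs = alt_wedge (S (Suc N)) (S' z) xs"
      by (rule alt_wedge_cong) (use eq set False in auto)
    finally show "form_det S' (insert z ({1..Suc N} - {v}))
      = (- S' z (Suc N) + alt_wedge (S (Suc N)) (S' z) xs)\<^sup>2"
      using skewD[OF sk, of "Suc N" z] by simp
  qed
qed

section \<open>Extension of L_n by a new vertex \<open>0\<close>\<close>

lemma L_form_extend_det:
  assumes L: "L_form N S"
    and xs: "set xs \<subseteq> {1..N}" "sorted_wrt (<) xs" "even (length xs)"
    and \<tau>: "\<And>p. p \<in> {1..N} \<Longrightarrow> S 0 p = (- 1) ^ p * \<tau> p"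
  shows "form_det S (insert (Suc N) (insert 0 (set xs)))
    = (S (Suc N) 0 + alt_wedge (\<lambda>i. - ((- 1) ^ i)) (\<lambda>i. (- 1) ^ i * \<tau> i) xs)\<^sup>2"
proof -
  have sk: "skew S" using L by (auto simp: L_form_def)
  have "form_det S (insert (Suc N) (insert 0 (set xs)))
    = (S (Suc N) 0 + alt_wedge (S (Suc N)) (S 0) xs)\<^sup>2"
    by (rule form_det_chain_insert2[OF sk L_form_chain[OF L xs(1,2)] xs(3)]) (use xs(1) in auto)
  also have "alt_wedge (S (Suc N)) (S 0) xs
      = alt_wedge (\<lambda>i. - ((- 1) ^ i)) (\<lambda>i. (- 1) ^ i * \<tau> i) xs"
    by (rule alt_wedge_cong) (use xs(1) \<tau> L in \<open>auto simp: L_form_def\<close>)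
  finally show ?thesis .
qed

text \<open>One deletion shifts the parity of all later positions, so pairs across the gap count
  with reversed sign. The closed form makes the step from \<open>w\<close> to \<open>w + 1\<close>
  visible: it is \<open>2 * t - N * (\<tau> w + \<tau> (w + 1))\<close>, where \<open>t\<close> is
  the sum of all \<open>\<tau> i\<close>.\<close>

lemma alt_wedge_delete1:
  fixes \<tau> :: "nat \<Rightarrow> int"
  assumes "w \<in> {1..N}"
  shows "alt_wedge (\<lambda>i. - ((- 1) ^ i)) (\<lambda>i. (- 1) ^ i * \<tau> i) ([1..<w] @ [Suc w..<Suc N])
    = - 2 * (\<Sum>i=1..N. int i * \<tau> i) + 2 * int w * (\<Sum>i=1..N. \<tau> i)
      + int N * ((\<Sum>i=1..N. \<tau> i) - 2 * (\<Sum>i=1..<w. \<tau> i) - \<tau> w)"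
proof -
  define T1 T2 U1 U2 where "T1 = (\<Sum>i=1..<w. \<tau> i)" and "T2 = (\<Sum>i=Suc w..<Suc N. \<tau> i)"
    and "U1 = (\<Sum>i=1..<w. int i * \<tau> i)" and "U2 = (\<Sum>i=Suc w..<Suc N. int i * \<tau> i)"
  have split: "(\<Sum>i=1..N. f i) = (\<Sum>i=1..<w. f i) + f w + (\<Sum>i=Suc w..<Suc N. f i)" for f :: "nat \<Rightarrow> int"
  proof -
    have "(\<Sum>i=1..N. f i) = (\<Sum>i=1..<w. f i) + (\<Sum>i=w..<Suc N. f i)"
      using assms by (subst sum.atLeastLessThan_concat) (auto simp: atLeastLessThanSuc_atLeastAtMost)
    also have "(\<Sum>i=w..<Suc N. f i) = f w + (\<Sum>i=Suc w..<Suc N. f i)"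
      using assms by (subst sum.atLeast_Suc_lessThan) auto
    finally show ?thesis by simp
  qed
  have w: "1 \<le> w" "w \<le> N" using assms by auto
  have "even (w - 1) = odd w" using w by simp
  then have "(- 1 :: int) ^ (w - 1) * (- 1) ^ w = - 1"
    by (auto simp: minus_one_power_iff)
  moreover define a b where "a = (\<lambda>i::nat. - ((- 1 :: int) ^ i))" and "b = (\<lambda>i. (- 1) ^ i * \<tau> i)"
  have ev: "alt_sum a [1..<w] = int w - 1" "alt_sum b [1..<w] = - T1"
    "alt_sum a [Suc w..<Suc N] = (- 1) ^ w * (int N - int w)" "alt_sum b [Suc w..<Suc N] = - ((- 1) ^ w * T2)"
    "alt_wedge a b [1..<w] = int w * T1 - 2 * U1"
    "alt_wedge a b [Suc w..<Suc N] = (int w + int N + 1) * T2 - 2 * U2"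
    using w alt_sum_upt_const[of 1 w] alt_sum_upt_const[of "Suc w" "Suc N"] alt_sum_upt[of 1 w \<tau>]
      alt_sum_upt[of "Suc w" "Suc N" \<tau>] alt_wedge_upt[of 1 w \<tau>] alt_wedge_upt[of "Suc w" "Suc N" \<tau>]
    unfolding a_def b_def T1_def T2_def U1_def U2_def by (simp_all del: upt_Suc sum.op_ivl_Suc)
  have "alt_wedge a b ([1..<w] @ [Suc w..<Suc N])
    = (int w * T1 - 2 * U1) + ((int w + int N + 1) * T2 - 2 * U2)
      - (- 1) ^ (w - 1) * (- 1) ^ w * ((int w - 1) * T2 - (int N - int w) * T1)"
    unfolding alt_wedge_append ev by (simp add: algebra_simps)
  ultimately show ?thesis
    unfolding a_def[symmetric] b_def[symmetric]
    unfolding split[of \<tau>] split[of "\<lambda>i. int i * \<tau> i"] T1_def[symmetric] T2_def[symmetric]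
      U1_def[symmetric] U2_def[symmetric]
    by (simp add: algebra_simps)
qed

text \<open>As on one interval, a pair \<open>i < j\<close> contributes
  \<open>\<tau> i - \<tau> j\<close>, now with one factor \<open>- 1\<close> for each deleted index
  between the two blocks.\<close>

lemma alt_wedge_upt3:
  fixes \<tau> :: "nat \<Rightarrow> int"
  assumes "1 \<le> a" "a \<le> b" "b \<le> c" "c \<le> d" "d \<le> e"
  defines "T \<equiv> \<lambda>p q. \<Sum>i=p..<q. \<tau> i" and "U \<equiv> \<lambda>p q. \<Sum>i=p..<q. int i * \<tau> i"
  shows "alt_wedge (\<lambda>i. - ((- 1) ^ i)) (\<lambda>i. (- 1) ^ i * \<tau> i) ([1..<a] @ [b..<c] @ [d..<e])
    = (int a * T 1 a - 2 * U 1 a) + ((int b + int c - 1) * T b c - 2 * U b c)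
      + ((int d + int e - 1) * T d e - 2 * U d e)
      + (- 1) ^ (a + b) * ((int c - int b) * T 1 a - (int a - 1) * T b c)
      + (- 1) ^ (a + b + c + d) * ((int e - int d) * T 1 a - (int a - 1) * T d e)
      + (- 1) ^ (c + d) * ((int e - int d) * T b c - (int c - int b) * T d e)"
proof -
  have "even (a - 1) = odd a" "even (c - b) = (even c = even b)"
    using assms(1,3) by auto
  then have "(- 1 :: int) ^ (a - 1) = - ((- 1) ^ a)" "(- 1 :: int) ^ (c - b) = (- 1) ^ c * (- 1) ^ b"
    by (auto simp: minus_one_power_iff)
  moreover define f g where "f = (\<lambda>i::nat. - ((- 1 :: int) ^ i))" and "g = (\<lambda>i. (- 1) ^ i * \<tau> i)"
  moreover have ev: "alt_sum f [p..<q] = - ((- 1) ^ p * (int q - int p))" "alt_sum g [p..<q] = (- 1) ^ p * T p q"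
    "alt_wedge f g [p..<q] = (int p + int q - 1) * T p q - 2 * U p q" if "p \<le> q" for p q
    using that unfolding f_def g_def T_def U_def
    by (rule alt_sum_upt_const, rule alt_sum_upt, rule alt_wedge_upt)
  ultimately show ?thesis
    using assms(1-5) unfolding f_def[symmetric] g_def[symmetric] alt_wedge_append alt_sum_append
    by (simp add: ev power_add algebra_simps)
qed

lemma sum_split2:
  fixes f :: "nat \<Rightarrow> int"
  shows "p \<le> q \<Longrightarrow> q < r \<Longrightarrow> (\<Sum>i=p..<r. f i) = (\<Sum>i=p..<q. f i) + f q + (\<Sum>i=Suc q..<r. f i)"
  using sum.atLeastLessThan_concat[of p q r f] sum.atLeast_Suc_lessThan[of q r f] by simp

text \<open>The reference is the deletion of \<open>l\<close> alone. Removing the adjacent indices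
  \<open>i\<close> and \<open>i + 1\<close> as well preserves the signs of all remaining pairs, so
  the difference comes only from pairs that involve \<open>i\<close> or
  \<open>i + 1\<close>.\<close>

lemma alt_wedge_delete3_low:
  fixes \<tau> :: "nat \<Rightarrow> int"
  assumes "1 \<le> i" "i + 1 < l" "l \<le> N" "\<tau> i = 1" "\<tau> (Suc i) = 1" "\<tau> l = 1"
  defines "W \<equiv> alt_wedge (\<lambda>i. - ((- 1) ^ i)) (\<lambda>i. (- 1) ^ i * \<tau> i)"
  shows "W ([1..<i] @ [i + 2..<l] @ [Suc l..<Suc N])
    = W ([1..<l] @ [Suc l..<Suc N]) - 2 * ((\<Sum>p=1..N. \<tau> p) - 3) + 4 * (\<Sum>p=i+2..<l. \<tau> p)
      - 4 * (int l - int i) + 2 + 2 * int N"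
proof -
  have s: "(\<Sum>p=1..N. f p) = (\<Sum>p=1..<l. f p) + f l + (\<Sum>p=Suc l..<Suc N. f p)"
    "(\<Sum>p=1..<l. f p) = (\<Sum>p=1..<i. f p) + f i + f (Suc i) + (\<Sum>p=i+2..<l. f p)" for f :: "nat \<Rightarrow> int"
    using sum_split2[of 1 l "Suc N" f] sum_split2[of 1 i l f] sum_split2[of "Suc i" "Suc i" l f] assms(1-3)
    by (simp_all add: atLeastLessThanSuc_atLeastAtMost)
  have p: "(- 1 :: int) ^ (i + (i + 2)) = 1" "(- 1 :: int) ^ (i + (i + 2) + l + Suc l) = - 1"
    "(- 1 :: int) ^ (l + Suc l) = - 1"
    by (auto simp: minus_one_power_iff)
  have d: "W ([1..<l] @ [Suc l..<Suc N]) = - 2 * (\<Sum>i=1..N. int i * \<tau> i) + 2 * int l * (\<Sum>i=1..N. \<tau> i)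
      + int N * ((\<Sum>i=1..N. \<tau> i) - 2 * (\<Sum>i=1..<l. \<tau> i) - \<tau> l)"
    unfolding W_def by (rule alt_wedge_delete1) (use assms in auto)
  show ?thesis
    unfolding d unfolding W_def s(1)[of \<tau>] s(1)[of "\<lambda>i. int i * \<tau> i"]
      s(2)[of \<tau>] s(2)[of "\<lambda>i. int i * \<tau> i"]
    using assms(1-6)
    by (subst alt_wedge_upt3) (simp_all only: p, auto simp: algebra_simps)
qed

text \<open>The counterpart with the deletion of \<open>i + 1\<close> alone as reference, where the
  adjacent indices \<open>l\<close> and \<open>l + 1\<close> are removed as well.\<close>

lemma alt_wedge_delete3_high:
  fixes \<tau> :: "nat \<Rightarrow> int"
  assumes "1 \<le> i" "i + 1 < l" "l < N" "\<tau> (Suc i) = 1" "\<tau> l = 1" "\<tau> (Suc l) = 1"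
  defines "W \<equiv> alt_wedge (\<lambda>i. - ((- 1) ^ i)) (\<lambda>i. (- 1) ^ i * \<tau> i)"
  shows "W ([1..<Suc i] @ [i + 2..<l] @ [l + 2..<Suc N])
    = W ([1..<Suc i] @ [Suc (Suc i)..<Suc N]) + 2 * ((\<Sum>p=1..N. \<tau> p) - 3) - 4 * (\<Sum>p=i+2..<l. \<tau> p)
      + 4 * (int l - int i) - 2 - 2 * int N"
proof -
  have s: "(\<Sum>p=1..N. f p) = (\<Sum>p=1..<Suc i. f p) + f (Suc i) + (\<Sum>p=i+2..<l. f p) + f l + f (Suc l)
      + (\<Sum>p=l+2..<Suc N. f p)" for f :: "nat \<Rightarrow> int"
    using sum_split2[of 1 "Suc i" "Suc N" f] sum_split2[of "Suc (Suc i)" l "Suc N" f]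
      sum_split2[of "Suc l" "Suc l" "Suc N" f] assms(1-3)
    by (simp add: atLeastLessThanSuc_atLeastAtMost)
  have p: "(- 1 :: int) ^ (Suc i + (i + 2)) = - 1" "(- 1 :: int) ^ (Suc i + (i + 2) + l + (l + 2)) = - 1"
    "(- 1 :: int) ^ (l + (l + 2)) = 1"
    by (auto simp: minus_one_power_iff)
  have d: "W ([1..<Suc i] @ [Suc (Suc i)..<Suc N])
      = - 2 * (\<Sum>i=1..N. int i * \<tau> i) + 2 * int (Suc i) * (\<Sum>i=1..N. \<tau> i)
      + int N * ((\<Sum>i=1..N. \<tau> i) - 2 * (\<Sum>i=1..<Suc i. \<tau> i) - \<tau> (Suc i))"
    unfolding W_def by (rule alt_wedge_delete1) (use assms in auto)
  show ?thesis
    unfolding d unfolding W_def s[of \<tau>] s[of "\<lambda>i. int i * \<tau> i"]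
    using assms(1-6)
    by (subst alt_wedge_upt3) (simp_all only: p, auto simp: algebra_simps simp del: sum.op_ivl_Suc)
qed

lemma square_le_imp_abs_le: "(x::int)\<^sup>2 \<le> (int m)\<^sup>2 \<Longrightarrow> \<bar>x\<bar> \<le> int m"
  using abs_le_square_iff[of x "int m"] by simp

text \<open>The classification of signs applies to the row of \<open>0\<close>. A constant sequence
  makes \<open>0\<close> proportional to the apex, an alternating one to a vertex of the path;
  \<open>s = 1\<close> and \<open>s = - 1\<close> correspond to covertices and revertices.\<close>

lemma L_form_extension:
  assumes L: "L_form N S"
    and pm: "\<And>p. p \<in> {1..Suc N} \<Longrightarrow> S 0 p = 1 \<or> S 0 p = - 1"
    and bnd: "\<And>A. A \<subseteq> {0..Suc N} \<Longrightarrow> form_det S A \<le> (int N)\<^sup>2"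
  obtains w s where "w \<in> {1..Suc N}" "s = 1 \<or> s = - 1"
    "\<And>p. p \<in> {1..Suc N} - {w} \<Longrightarrow> S 0 p = s * S w p"
proof -
  have sk: "skew S" and N: "odd N" "3 \<le> N" using L by (auto simp: L_form_def)
  define t0 where "t0 = (\<Sum>p=1..N. (- 1) ^ p * S 0 p)"
  have "odd t0"
  proof -
    have "even (\<Sum>p=1..N. (- 1) ^ p * S 0 p - 1)"
    proof (rule dvd_sum)
      fix p assume "p \<in> {1..N}"
      then show "even ((- 1) ^ p * S 0 p - 1)"
        using pm[of p] by (auto simp: minus_one_power_iff)
    qed
    then have "even (t0 - int N)" by (simp add: t0_def sum_subtractf)
    then show ?thesis using N by simp
  qed
  then have "t0 \<noteq> 0" by auto
  \<comment> \<open>The sign \<open>c\<close> makes the sum \<open>t\<close> positive and changes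
    the square roots of the determinants by at most a sign.\<close>
  define c :: int where "c = sgn t0"
  have c: "c = 1 \<or> c = - 1" "c * c = 1" using \<open>t0 \<noteq> 0\<close> by (auto simp: c_def sgn_if)
  define \<tau> where "\<tau> p = c * ((- 1) ^ p * S 0 p)" for p
  define t where "t = (\<Sum>p=1..N. \<tau> p)"
  have "t = c * t0" by (simp add: t_def t0_def \<tau>_def sum_distrib_left)
  then have t: "0 < t" using \<open>t0 \<noteq> 0\<close> by (simp add: c_def sgn_if)
  have S0: "S 0 p = c * ((- 1) ^ p * \<tau> p)" for p
    using c by (auto simp: \<tau>_def)
  define W where "W = alt_wedge (\<lambda>i. - ((- 1) ^ i)) (\<lambda>i. (- 1) ^ i * \<tau> i)"
  define Y where "Y w = c * S (Suc N) 0 + W ([1..<w] @ [Suc w..<Suc N])" for w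
  have bound: "\<bar>c * S (Suc N) 0 + W xs\<bar> \<le> int N"
    if xs: "set xs \<subseteq> {1..N}" "sorted_wrt (<) xs" "even (length xs)" for xs
  proof -
    have "form_det S (insert (Suc N) (insert 0 (set xs)))
      = (S (Suc N) 0 + alt_wedge (\<lambda>i. - ((- 1) ^ i)) (\<lambda>i. (- 1) ^ i * (c * \<tau> i)) xs)\<^sup>2"
      by (rule L_form_extend_det[OF L xs]) (simp add: S0)
    also have "alt_wedge (\<lambda>i. - ((- 1) ^ i)) (\<lambda>i. (- 1) ^ i * (c * \<tau> i)) xs = c * W xs"
      using alt_wedge_lin[of "\<lambda>i. - ((- 1) ^ i)" c "\<lambda>i. (- 1) ^ i * \<tau> i" 0 "\<lambda>_. 0" xs]
      by (simp add: W_def mult.left_commute)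
    also have "(S (Suc N) 0 + c * W xs)\<^sup>2 = (c * S (Suc N) 0 + W xs)\<^sup>2"
      using c by (auto simp: power2_eq_square algebra_simps)
    finally have "(c * S (Suc N) 0 + W xs)\<^sup>2 \<le> (int N)\<^sup>2"
      using bnd[of "insert (Suc N) (insert 0 (set xs))"] xs(1) by force
    then show ?thesis by (rule square_le_imp_abs_le)
  qed
  have Wd: "W ([1..<w] @ [Suc w..<Suc N]) = - 2 * (\<Sum>i=1..N. int i * \<tau> i) + 2 * int w * t
      + int N * (t - 2 * (\<Sum>i=1..<w. \<tau> i) - \<tau> w)" if "w \<in> {1..N}" for w
    unfolding W_def t_def by (rule alt_wedge_delete1[OF that])
  have "(\<forall>p\<in>{1..N}. \<tau> p = 1) \<or>
    (\<exists>w\<in>{1..N}. \<forall>p\<in>{1..N}. \<tau> p = (if w \<le> p then (- 1) ^ (p + w) else - ((- 1) ^ (p + w))))"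
  proof (rule sign_sequence_classification[OF N(1) _ t_def t, of Y])
    show "\<tau> p = 1 \<or> \<tau> p = - 1" if "p \<in> {1..N}" for p
      using pm[of p] c that by (auto simp: \<tau>_def minus_one_power_iff)
    show "\<bar>Y w\<bar> \<le> int N" if "w \<in> {1..N}" for w
      unfolding Y_def by (rule bound) (use that N in \<open>auto simp: sorted_wrt_append simp del: upt_Suc\<close>)
    show "Y (cyc_suc N w) = Y w + 2 * t - int N * (\<tau> w + \<tau> (cyc_suc N w))" if w: "w \<in> {1..N}" for w
    proof (cases "w = N")
      case True
      have "t = (\<Sum>i=1..<N. \<tau> i) + \<tau> N"
        using N by (simp add: t_def sum.last_plus[of 1 N] atLeastLessThanSuc_atLeastAtMost[symmetric])
      then show ?thesis
        using N True Wd[of 1] Wd[of N] unfolding Y_def cyc_suc_def by (simp add: algebra_simps)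
    next
      case False
      then have w': "Suc w \<in> {1..N}" using w by auto
      show ?thesis
        using w False Wd[OF w] Wd[OF w'] unfolding Y_def cyc_suc_def by (simp add: algebra_simps)
    qed
    show "\<bar>Y l - 2 * (t - 3) + 4 * (\<Sum>p=i+2..<l. \<tau> p) - 4 * (int l - int i) + 2 + 2 * int N\<bar> \<le> int N"
      if "1 \<le> i" "i + 1 < l" "l < N" "\<tau> i = 1" "\<tau> (Suc i) = 1" "\<tau> l = 1" "\<tau> (Suc l) = 1" for i l
    proof -
      have "\<bar>c * S (Suc N) 0 + W ([1..<i] @ [i + 2..<l] @ [Suc l..<Suc N])\<bar> \<le> int N"
        by (rule bound) (use that N in \<open>auto simp: sorted_wrt_append simp del: upt_Suc\<close>)
      then show ?thesis
        using alt_wedge_delete3_low[of i l N \<tau>] that unfolding W_def[symmetric] t_def[symmetric] Y_def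
        by (simp add: algebra_simps)
    qed
    show "\<bar>Y (Suc i) + 2 * (t - 3) - 4 * (\<Sum>p=i+2..<l. \<tau> p) + 4 * (int l - int i) - 2 - 2 * int N\<bar> \<le> int N"
      if "1 \<le> i" "i + 1 < l" "l < N" "\<tau> i = 1" "\<tau> (Suc i) = 1" "\<tau> l = 1" "\<tau> (Suc l) = 1" for i l
    proof -
      have "\<bar>c * S (Suc N) 0 + W ([1..<Suc i] @ [i + 2..<l] @ [l + 2..<Suc N])\<bar> \<le> int N"
        by (rule bound) (use that N in \<open>auto simp: sorted_wrt_append simp del: upt_Suc\<close>)
      then show ?thesis
        using alt_wedge_delete3_high[of i l N \<tau>] that unfolding W_def[symmetric] t_def[symmetric] Y_def
        by (simp add: algebra_simps)
    qed
  qed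
  then consider (one) "\<forall>p\<in>{1..N}. \<tau> p = 1"
    | (alt) w where "w \<in> {1..N}"
        "\<And>p. p \<in> {1..N} \<Longrightarrow> \<tau> p = (if w \<le> p then (- 1) ^ (p + w) else - ((- 1) ^ (p + w)))"
    by blast
  then show ?thesis
  proof cases
    case one
    show ?thesis
    proof (rule that[of "Suc N" "- c"])
      fix p assume "p \<in> {1..Suc N} - {Suc N}"
      then have "p \<in> {1..N}" by auto
      then show "S 0 p = - c * S (Suc N) p"
        using one L S0[of p] by (simp add: L_form_def)
    qed (use c in auto)
  next
    case (alt w)
    have path: "S p q = 1" "S q p = - 1" if "1 \<le> p" "p < q" "q \<le> N" for p q
      using L that skewD[OF sk, of q p] by (auto simp: L_form_def)
    have apex: "S p (Suc N) = (- 1) ^ p" if "p \<in> {1..N}" for p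
      using L that skewD[OF sk, of p "Suc N"] by (auto simp: L_form_def)
    have S0': "S 0 p = (if w \<le> p then c * (- 1) ^ w else - (c * (- 1) ^ w))" if "p \<in> {1..N}" for p
      using alt(2)[OF that] S0[of p] by (simp add: power_add)
    have e: "c * (- 1) ^ w = 1 \<or> c * (- 1) ^ w = - 1"
      using c by (auto simp: minus_one_power_iff)
    \<comment> \<open>On the path, \<open>0\<close> looks up to sign like a vertex inserted between
      \<open>w - 1\<close> and \<open>w\<close>. These two have opposite entries at the apex, so the
      entry of \<open>0\<close> there decides between them.\<close>
    show ?thesis
    proof (cases "S 0 (Suc N) = c")
      case True
      show ?thesis
      proof (rule that[of w "c * (- 1) ^ w"])
        fix p assume p: "p \<in> {1..Suc N} - {w}"
        show "S 0 p = c * (- 1) ^ w * S w p"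
        proof (cases "p = Suc N")
          case False
          then show ?thesis
            using p alt(1) S0'[of p] path[of w p] path[of p w] by auto
        qed (use True apex[OF alt(1)] in \<open>simp add: mult.assoc\<close>)
      qed (use e alt(1) in auto)
    next
      case False
      then have last: "S 0 (Suc N) = - c" using pm[of "Suc N"] c by auto
      show ?thesis
      proof (cases "w = 1")
        case True
        \<comment> \<open>The cyclic predecessor of \<open>1\<close> is \<open>N\<close>, which all
          other path vertices dominate; its row times \<open>c\<close> is that of
          \<open>0\<close>.\<close>
        show ?thesis
        proof (rule that[of N c])
          fix p assume p: "p \<in> {1..Suc N} - {N}"
          show "S 0 p = c * S N p"
          proof (cases "p = Suc N")
            case False
            then show ?thesis
              using p True S0'[of p] path[of p N] by auto
          qed (use last apex[of N] N in auto)
        qed (use c N in auto)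
      next
        case False
        show ?thesis
        proof (rule that[of "w - 1" "c * (- 1) ^ w"])
          fix p assume p: "p \<in> {1..Suc N} - {w - 1}"
          show "S 0 p = c * (- 1) ^ w * S (w - 1) p"
          proof (cases "p = Suc N")
            case True
            have "(- 1 :: int) ^ w * (- 1) ^ (w - 1) = - 1"
              using alt(1) by (cases w) auto
            moreover have "w - 1 \<in> {1..N}" using alt(1) False by auto
            ultimately show ?thesis
              using True last apex[of "w - 1"] by (simp add: mult.assoc)
          next
            case False
            then have p': "p \<in> {1..N}" "1 \<le> w - 1" "w \<le> p \<or> p < w - 1" "w - 1 \<le> N"
              using p alt(1) \<open>w \<noteq> 1\<close> by auto
            then have "S (w - 1) p = (if w \<le> p then 1 else - 1)"
              using path(1)[of "w - 1" p] path(2)[of p "w - 1"] by auto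
            then show ?thesis using S0'[OF p'(1)] by simp
          qed
        qed (use e alt(1) False in auto)
      qed
    qed
  qed
qed

section \<open>Blowups of L_n at one vertex, as forms\<close>

text \<open>The form of the 1-transitive blowup at \<open>v\<close>, which may be the apex;
  \<open>Suc (Suc N)\<close> is the second copy of \<open>v\<close>, dominated by the first.\<close>

definition twin_form :: "nat \<Rightarrow> (nat \<Rightarrow> nat \<Rightarrow> int) \<Rightarrow> nat \<Rightarrow> bool" where
  "twin_form N S v \<longleftrightarrow> L_form N S \<and> v \<in> {1..Suc N} \<and> S v (Suc (Suc N)) = 1 \<and>
     (\<forall>q\<in>{1..Suc N} - {v}. S (Suc (Suc N)) q = S v q)"

text \<open>The pivot correction is up to sign a 2x2 minor of the rows of \<open>x\<close> and
  \<open>y\<close>, which vanishes as these are proportional on \<open>A\<close>.\<close>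

lemma form_det_pivot_proportional:
  assumes sk: "skew S" and A: "finite A" "x \<notin> A" "y \<notin> A" "x \<noteq> y"
    and xy: "S x y = 1 \<or> S x y = - 1" and row: "\<And>q. q \<in> A \<Longrightarrow> S x q = s * S y q"
  shows "form_det S (insert x (insert y A)) = form_det S A"
proof -
  have qx: "S q x = - (s * S y q)" "S q y = - S y q" if "q \<in> A" for q
    using row[OF that] skewD[OF sk, of q x] skewD[OF sk, of q y] by auto
  show ?thesis
  proof (cases "S x y = 1")
    case True
    have "form_det S (insert x (insert y A))
        = form_det (\<lambda>p q. S p q + S p x * S y q - S p y * S x q) A"
      using True A sk by (intro form_det_pivot) auto
    also have "\<dots> = form_det S A"
      by (rule form_det_cong[OF A(1)]) (simp add: qx row)
    finally show ?thesis .
  next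
    case False
    then have yx: "S y x = 1" using xy skewD[OF sk, of y x] by auto
    have "form_det S (insert x (insert y A)) = form_det S (insert y (insert x A))"
      by (simp add: insert_commute)
    also have "\<dots> = form_det (\<lambda>p q. S p q + S p y * S x q - S p x * S y q) A"
      using yx A sk by (intro form_det_pivot) auto
    also have "\<dots> = form_det S A"
      by (rule form_det_cong[OF A(1)]) (simp add: qx row)
    finally show ?thesis .
  qed
qed

text \<open>In a set with the twin but without \<open>v\<close>, the twin can be renamed to
  \<open>v\<close>; from a set with both, a pivot removes the two. Either way a subset of the
  vertices of L_n remains.\<close>

lemma twin_form_sub_det:
  assumes T: "twin_form N S v" and A: "A \<subseteq> {1..Suc (Suc N)}" "even (card A)"
  shows "form_det S A \<le> (int N)\<^sup>2"
proof -
  let ?v' = "Suc (Suc N)"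
  have L: "L_form N S" and v: "v \<in> {1..Suc N}" and tw: "\<And>q. q \<in> {1..Suc N} - {v} \<Longrightarrow> S ?v' q = S v q"
    and vv: "S v ?v' = 1"
    using T by (auto simp: twin_form_def)
  have sk: "skew S" and N: "odd N" "3 \<le> N" using L by (auto simp: L_form_def)
  have fin: "finite A" using A(1) finite_subset by blast
  have base: "form_det S B \<le> (int N)\<^sup>2" if "B \<subseteq> {1..Suc N}" "even (card B)" for B
    by (rule L_form_sub_det[OF L that]) (use N card_mono[OF _ that(1)] in auto)
  consider "?v' \<notin> A" | "?v' \<in> A" "v \<notin> A" | "?v' \<in> A" "v \<in> A" by blast
  then show ?thesis
  proof cases
    case 1
    then have "A \<subseteq> {1..Suc N}" using A(1) by (auto simp: subset_iff le_Suc_eq)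
    then show ?thesis using base A(2) by blast
  next
    case 2
    define B where "B = insert v (A - {?v'})"
    define f where "f = id(v := ?v')"
    have B: "B \<subseteq> {1..Suc N}" using A(1) v by (auto simp: B_def subset_iff le_Suc_eq)
    have inj: "inj_on f B" using 2 by (auto simp: f_def inj_on_def B_def)
    have im: "f ` B = A" using 2 by (auto simp: f_def B_def image_iff)
    have "form_det S A = form_det (\<lambda>x y. S (f x) (f y)) B"
      using form_det_image[OF _ inj, of S] im fin by (simp add: B_def)
    also have "\<dots> = form_det S B"
    proof (rule form_det_cong)
      fix x y assume xy: "x \<in> B" "y \<in> B"
      have "S p ?v' = S p v" if "p \<in> {1..Suc N} - {v}" for p
        using tw[OF that] skewD[OF sk, of p v] skewD[OF sk, of p ?v'] by simp
      then show "S (f x) (f y) = S x y"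
        using xy B tw by (auto simp: f_def skew_self[OF sk])
    qed (use fin in \<open>simp add: B_def\<close>)
    also have "\<dots> \<le> (int N)\<^sup>2"
      using B A(2) card_image[OF inj] im by (intro base) auto
    finally show ?thesis .
  next
    case 3
    define B where "B = A - {v, ?v'}"
    have B: "B \<subseteq> {1..Suc N}" using A(1) by (auto simp: B_def subset_iff le_Suc_eq)
    have AB: "A = insert ?v' (insert v B)" using 3 by (auto simp: B_def)
    have "form_det S (insert ?v' (insert v B)) = form_det S B"
    proof (rule form_det_pivot_proportional[where s=1])
      show "S ?v' v = 1 \<or> S ?v' v = - 1" using vv skewD[OF sk, of ?v' v] by simp
      show "S ?v' q = 1 * S v q" if "q \<in> B" for q
        using that B tw[of q] by (auto simp: B_def)
    qed (use sk fin v in \<open>auto simp: B_def\<close>)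
    moreover have "card A = card B + 2"
      unfolding AB using fin v by (subst card_insert_disjoint; simp add: B_def)+
    ultimately show ?thesis
      using base[OF B] A(2) AB by simp
  qed
qed

text \<open>The vertices other than the twin supply \<open>w\<close> and \<open>s\<close>. If the
  entries of \<open>0\<close> at \<open>v\<close> and its twin agree, \<open>w\<close> still works,
  or one of the twins does when \<open>w = v\<close>. If they differ, a pivot on the twins forces
  \<open>w = v\<close> and the required sign.\<close>

lemma twin_form_extension:
  assumes T: "twin_form N S v"
    and pm: "\<And>p. p \<in> {1..Suc (Suc N)} \<Longrightarrow> S 0 p = 1 \<or> S 0 p = - 1"
    and bnd: "\<And>A. A \<subseteq> {0..Suc (Suc N)} \<Longrightarrow> form_det S A \<le> (int N)\<^sup>2"
  obtains w s where "w \<in> {1..Suc (Suc N)}" "s = 1 \<or> s = - 1"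
    "\<And>p. p \<in> {1..Suc (Suc N)} - {w} \<Longrightarrow> S 0 p = s * S w p"
proof -
  let ?v' = "Suc (Suc N)" and ?V = "{1..Suc N}"
  have L: "L_form N S" and v: "v \<in> ?V" and tw: "\<And>q. q \<in> ?V - {v} \<Longrightarrow> S ?v' q = S v q"
    and vv: "S v ?v' = 1"
    using T by (auto simp: twin_form_def)
  have sk: "skew S" and N: "odd N" "3 \<le> N" using L by (auto simp: L_form_def)
  have tw': "S q ?v' = S q v" if "q \<in> ?V - {v}" for q
    using tw[OF that] skewD[OF sk, of q v] skewD[OF sk, of q ?v'] by simp
  have vv': "S ?v' v = - 1" using vv skewD[OF sk, of ?v' v] by simp
  obtain w s where ws: "w \<in> ?V" "s = 1 \<or> s = - 1" "\<And>p. p \<in> ?V - {w} \<Longrightarrow> S 0 p = s * S w p"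
  proof (rule L_form_extension[OF L])
    show "S 0 p = 1 \<or> S 0 p = - 1" if "p \<in> ?V" for p
      using pm[of p] that by simp
    show "form_det S A \<le> (int N)\<^sup>2" if "A \<subseteq> {0..Suc N}" for A
      by (rule bnd) (use that in force)
  qed blast
  \<comment> \<open>If \<open>0\<close> is proportional to the common row of the twins, only their
    mutual arc matters: the twin serves if \<open>S 0 v = s * S ?v' v = - s\<close>, and
    \<open>v\<close> serves if \<open>S 0 ?v' = s * S v ?v' = s\<close>.\<close>
  have at_v: "\<exists>x\<in>{v, ?v'}. \<forall>p\<in>{1..?v'} - {x}. S 0 p = s * S x p"
    if "w = v" "S 0 v = - s \<or> S 0 ?v' = s"
    using that(2)
  proof
    assume "S 0 v = - s"
    have "S 0 p = s * S ?v' p" if "p \<in> ?V" for p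
      using that ws(3)[of p] \<open>w = v\<close> tw[of p] vv' \<open>S 0 v = - s\<close> by (cases "p = v") auto
    moreover have "{1..?v'} - {?v'} = ?V" by auto
    ultimately have "\<forall>p\<in>{1..?v'} - {?v'}. S 0 p = s * S ?v' p"
      by simp
    then show ?thesis by blast
  next
    assume "S 0 ?v' = s"
    have "S 0 p = s * S v p" if "p \<in> {1..?v'} - {v}" for p
      using that ws(3)[of p] \<open>w = v\<close> vv \<open>S 0 ?v' = s\<close> by (cases "p = ?v'") auto
    then show ?thesis by blast
  qed
  show ?thesis
  proof (cases "S 0 v = S 0 ?v'")
    case True
    show ?thesis
    proof (cases "w = v")
      case w: True
      have "S 0 v = - s \<or> S 0 ?v' = s" using True pm[of v] v ws(2) by auto
      then obtain x where "x \<in> {v, ?v'}" "\<forall>p\<in>{1..?v'} - {x}. S 0 p = s * S x p"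
        using at_v w by blast
      then show ?thesis using that[of x s] ws(2) v by auto
    next
      case False
      have "S 0 p = s * S w p" if "p \<in> {1..?v'} - {w}" for p
        using that ws(3)[of p] ws(3)[of v] True False v tw'[of w] ws(1) by (cases "p = ?v'") auto
      then show ?thesis using that[of w s] ws by simp
    qed
  next
    case False
    define a where "a = S 0 v"
    have a: "a = 1 \<or> a = - 1" "S 0 v = a" "S 0 ?v' = - a"
      using False pm[of v] pm[of ?v'] v by (auto simp: a_def)
    obtain \<phi> :: "(nat \<Rightarrow> int) \<Rightarrow> int" where
      loc: "\<forall>f g. (\<forall>x\<in>?V - {v}. f x = g x) \<longrightarrow> \<phi> f = \<phi> g" and
      lin: "\<forall>c d f g. \<phi> (\<lambda>x. c * f x + d * g x) = c * \<phi> f + d * \<phi> g" and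
      det: "\<forall>S' z. skew S' \<longrightarrow> (\<forall>p\<in>?V - {v}. \<forall>q\<in>?V - {v}. S' p q = S p q) \<longrightarrow>
         z \<notin> ?V - {v} \<longrightarrow> form_det S' (insert z (?V - {v})) = (\<phi> (S' z))\<^sup>2"
      using L_form_delete_linear[OF L v] by (elim exE conjE)
    \<comment> \<open>For \<open>z = v\<close> the functional recovers the determinant of L_n
      itself.\<close>
    have dv: "(\<phi> (S v))\<^sup>2 = (int N)\<^sup>2"
      using det[rule_format, OF sk, of v] L_form_det[OF L] v by (simp add: insert_absorb)
    then have av: "\<bar>\<phi> (S v)\<bar> = int N"
      by (metis abs_of_nat power2_eq_iff abs_minus_cancel)
    define S' where "S' = (\<lambda>p q. S p q + S p v * S ?v' q - S p ?v' * S v q)"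
    have "form_det S (insert v (insert ?v' (insert 0 (?V - {v})))) = form_det S' (insert 0 (?V - {v}))"
      unfolding S'_def by (rule form_det_pivot[OF sk]) (use v vv in auto)
    also have "\<dots> = (\<phi> (S' 0))\<^sup>2"
    proof (rule det[rule_format])
      show "skew S'" unfolding S'_def by (rule skew_pivot[OF sk])
      show "S' p q = S p q" if "p \<in> ?V - {v}" "q \<in> ?V - {v}" for p q
        using tw tw' that by (simp add: S'_def)
    qed simp
    \<comment> \<open>The entries \<open>a\<close> and \<open>- a\<close> of \<open>0\<close> at the
      twins make both pivot terms equal to \<open>a * S v x\<close>.\<close>
    also have "\<phi> (S' 0) = \<phi> (\<lambda>x. 1 * S 0 x + 2 * a * S v x)"
      by (rule loc[rule_format]) (simp add: S'_def a tw)
    also have "\<dots> = \<phi> (S 0) + 2 * a * \<phi> (S v)"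
      by (subst lin[rule_format]) simp
    finally have "(\<phi> (S 0) + 2 * a * \<phi> (S v))\<^sup>2 \<le> (int N)\<^sup>2"
      using bnd[of "insert v (insert ?v' (insert 0 (?V - {v})))"] v by force
    then have le: "\<bar>\<phi> (S 0) + 2 * a * \<phi> (S v)\<bar> \<le> int N"
      by (rule square_le_imp_abs_le)
    show ?thesis
    proof (cases "w = v")
      case w: True
      have "\<phi> (S 0) = \<phi> (\<lambda>x. s * S v x + 0 * S v x)"
        by (rule loc[rule_format]) (use ws(3) w in auto)
      also have "\<dots> = s * \<phi> (S v)" by (subst lin[rule_format]) simp
      \<comment> \<open>For \<open>a = s\<close> the left side of \<open>le\<close> would be
        \<open>3 * N\<close>.\<close>
      finally have "a \<noteq> s" using le av ws(2) N by auto
      then have "S 0 v = - s" using a ws(2) by auto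
      then obtain x where "x \<in> {v, ?v'}" "\<forall>p\<in>{1..?v'} - {x}. S 0 p = s * S x p"
        using at_v w by blast
      then show ?thesis using that[of x s] ws(2) v by auto
    next
      case w: False
      define B where "B = ?V - {v, w}"
      have cB: "card B = N - 1" using v ws(1) w by (simp add: B_def card_Diff_subset)
      have "(\<phi> (S 0))\<^sup>2 = form_det S (insert 0 (?V - {v}))"
        using det[rule_format, OF sk, of 0] by simp
      also have "insert 0 (?V - {v}) = insert 0 (insert w B)"
        using ws(1) w by (auto simp: B_def)
      also have "form_det S (insert 0 (insert w B)) = form_det S B"
      proof (rule form_det_pivot_proportional[where s=s])
        show "S 0 w = 1 \<or> S 0 w = - 1" using pm[of w] ws(1) by simp
        show "S 0 q = s * S w q" if "q \<in> B" for q
          using that ws(3)[of q] by (simp add: B_def)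
      qed (use sk ws(1) in \<open>auto simp: B_def\<close>)
      also have "\<dots> \<le> (int (N - 2))\<^sup>2"
        by (rule L_form_sub_det[OF L]) (use cB N in \<open>auto simp: B_def\<close>)
      finally have "\<bar>\<phi> (S 0)\<bar> \<le> int (N - 2)" by (rule square_le_imp_abs_le)
      \<comment> \<open>The left side of \<open>le\<close> would be at least
        \<open>2 * N - (N - 2)\<close>.\<close>
      then have False using le av a(1) N by auto
      then show ?thesis ..
    qed
  qed
qed

section \<open>Tournaments and their forms\<close>

text \<open>The entries of the skew-adjacency matrix. A difference of indicators is skew everywhere,
  whereas \<open>theta\<close> is \<open>- 1\<close> on all pairs that are not arcs, including the
  diagonal.\<close>

definition arc_form :: "'a pair_pre_digraph \<Rightarrow> 'a \<Rightarrow> 'a \<Rightarrow> int" where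
  "arc_form T u v = of_bool ((u, v) \<in> parcs T) - of_bool ((v, u) \<in> parcs T)"

lemma skew_arc_form: "skew (arc_form T)"
  by (simp add: skew_def arc_form_def)

lemma skew_comp: "skew S \<Longrightarrow> skew (\<lambda>x y. S (f x) (f y))"
  unfolding skew_def by blast

lemma tournament_def':
  "tournament T \<longleftrightarrow> finite (pverts T) \<and> parcs T \<subseteq> pverts T \<times> pverts T \<and>
     (\<forall>u. (u, u) \<notin> parcs T) \<and>
     (\<forall>u\<in>pverts T. \<forall>v\<in>pverts T. u \<noteq> v \<longrightarrow> ((u, v) \<in> parcs T) \<noteq> ((v, u) \<in> parcs T))"
proof -
  have "(\<forall>e. e \<in> parcs T \<longrightarrow> fst e \<in> pverts T) \<and> (\<forall>e. e \<in> parcs T \<longrightarrow> snd e \<in> pverts T)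
      \<longleftrightarrow> parcs T \<subseteq> pverts T \<times> pverts T"
    by (force simp: mem_Times_iff)
  moreover have "(\<forall>e. e \<in> parcs T \<longrightarrow> fst e \<noteq> snd e) \<longleftrightarrow> (\<forall>u. (u, u) \<notin> parcs T)"
    by force
  moreover have "finite (parcs T)" if "finite (pverts T)" "parcs T \<subseteq> pverts T \<times> pverts T"
    by (rule finite_subset[OF that(2)]) (use that(1) in simp)
  ultimately show ?thesis
    unfolding tournament_def pair_digraph_def pair_fin_digraph_def pair_wf_digraph_def
      pair_fin_digraph_axioms_def pair_loopfree_digraph_def pair_loopfree_digraph_axioms_def
    by blast
qed

lemma tournament_asym:
  assumes "tournament T" "(u, v) \<in> parcs T"
  shows "(v, u) \<notin> parcs T"
proof -
  have "u \<noteq> v" "u \<in> pverts T" "v \<in> pverts T"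
    using assms unfolding tournament_def' by auto
  then show ?thesis
    using assms unfolding tournament_def' by blast
qed

lemma arc_form_tournament:
  assumes "tournament T" "u \<in> pverts T" "v \<in> pverts T" "u \<noteq> v"
  shows "arc_form T u v = theta T u v" "arc_form T u v = 1 \<or> arc_form T u v = - 1"
proof -
  have "((u, v) \<in> parcs T) \<noteq> ((v, u) \<in> parcs T)"
    using assms unfolding tournament_def' by blast
  then show "arc_form T u v = theta T u v" "arc_form T u v = 1 \<or> arc_form T u v = - 1"
    by (auto simp: arc_form_def theta_def)
qed

lemma tdet_arc_form:
  assumes "finite (pverts T)" "\<And>u v. (u, v) \<in> parcs T \<Longrightarrow> (v, u) \<notin> parcs T"
  shows "tdet T = form_det (arc_form T) (pverts T)"
proof -
  obtain vs where vs: "distinct vs" "set vs = pverts T"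
    using finite_distinct_list[OF assms(1)] by metis
  have "skew_adj_mat T vs = form_mat (arc_form T) vs"
    by (rule eq_matI) (use assms(2) in \<open>auto simp: skew_adj_mat_def form_mat_def arc_form_def\<close>)
  then show ?thesis
    using tdet_eq[OF vs] form_det_eq[OF vs, of "arc_form T"] by simp
qed

text \<open>Induced subtournaments correspond to vertex subsets, and their forms are restrictions of
  \<open>arc_form T\<close>.\<close>

lemma D_class_iff:
  "T \<in> D_class k \<longleftrightarrow> 1 \<le> k \<and> tournament T \<and> (\<forall>A\<subseteq>pverts T. form_det (arc_form T) A \<le> k\<^sup>2)"
proof (cases "tournament T")
  case T: True
  have wf: "wf_digraph (with_proj T)"
    using T unfolding tournament_def' by unfold_locales auto
  have fin: "finite (pverts T)" using T unfolding tournament_def' by blast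
  have sub: "tdet H = form_det (arc_form T) (pverts H) \<and> pverts H \<subseteq> pverts T"
    if H: "induced_subgraph (with_proj H) (with_proj T)" for H
  proof -
    have vH: "pverts H \<subseteq> pverts T" and aH: "parcs H = {e \<in> parcs T. fst e \<in> pverts H \<and> snd e \<in> pverts H}"
      using H unfolding induced_subgraph_def subgraph_def by auto
    have finH: "finite (pverts H)" using finite_subset[OF vH fin] .
    have "tdet H = form_det (arc_form H) (pverts H)"
      using finH aH tournament_asym[OF T] by (intro tdet_arc_form) auto
    also have "\<dots> = form_det (arc_form T) (pverts H)"
      by (rule form_det_cong[OF finH]) (simp add: aH arc_form_def)
    finally show ?thesis using vH by simp
  qed
  have "\<exists>H. induced_subgraph (with_proj H) (with_proj T) \<and> pverts H = A" if "A \<subseteq> pverts T" for A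
  proof (intro exI conjI)
    let ?H = "\<lparr>pverts = A, parcs = {e \<in> parcs T. fst e \<in> A \<and> snd e \<in> A}\<rparr>"
    have "wf_digraph (with_proj ?H)" by unfold_locales auto
    then show "induced_subgraph (with_proj ?H) (with_proj T)"
      using that wf unfolding induced_subgraph_def subgraph_def compatible_def by auto
    show "pverts ?H = A" by simp
  qed
  then have "(\<forall>H. induced_subgraph (with_proj H) (with_proj T) \<longrightarrow> tdet H \<le> k\<^sup>2)
      \<longleftrightarrow> (\<forall>A\<subseteq>pverts T. form_det (arc_form T) A \<le> k\<^sup>2)"
    using sub by metis
  then show ?thesis
    using T unfolding D_class_def by simp
qed (simp add: D_class_def)

section \<open>A criterion for CR tournaments in terms of forms\<close>

lemma CR_associated_proportional:
  assumes T: "tournament T" and uw: "u \<in> pverts T" "w \<in> pverts T" "u \<noteq> w" "3 \<le> card (pverts T)"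
    and s: "s = 1 \<or> s = - 1"
    and row: "\<And>x. x \<in> pverts T - {u, w} \<Longrightarrow> arc_form T u x = s * arc_form T w x"
  shows "CR_associated T u w"
proof -
  have "theta T u x = s * theta T w x" if "x \<in> pverts T - {u, w}" for x
  proof -
    have "x \<in> pverts T" "u \<noteq> x" "w \<noteq> x" using that by auto
    then show ?thesis
      using row[OF that] uw arc_form_tournament(1)[OF T] by simp
  qed
  then show ?thesis
    using s uw unfolding CR_associated_def covertices_def revertices_def by auto
qed

text \<open>The labels \<open>1..m\<close> stand for the vertices and \<open>0\<close> for the new
  one, so that the condition concerns forms on the naturals. The hypotheses \<open>sub\<close> and
  \<open>big\<close> place \<open>T\<close> in \<open>D_class k - D_class (k - 2)\<close>;
  proportional rows make the new vertex a CR vertex.\<close>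

lemma CR_tournamentI:
  fixes T :: "'a :: infinite pair_pre_digraph" and f :: "nat \<Rightarrow> 'a"
  assumes T: "tournament T" and f: "bij_betw f {1..m} (pverts T)" and m: "2 \<le> m" and k: "odd k" "3 \<le> k"
    and sub: "\<And>A. A \<subseteq> {1..m} \<Longrightarrow> form_det (\<lambda>x y. arc_form T (f x) (f y)) A \<le> k\<^sup>2"
    and big: "A0 \<subseteq> {1..m}" "form_det (\<lambda>x y. arc_form T (f x) (f y)) A0 = k\<^sup>2"
    and extend: "\<And>S. skew S \<Longrightarrow> (\<And>x y. x \<in> {1..m} \<Longrightarrow> y \<in> {1..m} \<Longrightarrow> S x y = arc_form T (f x) (f y)) \<Longrightarrow>
        (\<And>p. p \<in> {1..m} \<Longrightarrow> S 0 p = 1 \<or> S 0 p = - 1) \<Longrightarrow>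
        (\<And>A. A \<subseteq> {0..m} \<Longrightarrow> form_det S A \<le> k\<^sup>2) \<Longrightarrow>
        \<exists>w\<in>{1..m}. \<exists>s. (s = 1 \<or> s = - 1) \<and> (\<forall>p\<in>{1..m} - {w}. S 0 p = s * S w p)"
  shows "CR_tournament T"
proof -
  have inj: "inj_on f {1..m}" and im: "f ` {1..m} = pverts T"
    using f by (auto simp: bij_betw_def)
  have pull: "form_det (arc_form T) (f ` A) = form_det (\<lambda>x y. arc_form T (f x) (f y)) A"
    if "A \<subseteq> {1..m}" for A
    by (rule form_det_image) (use that finite_subset inj_on_subset[OF inj] in auto)
  have "T \<in> D_class k"
    unfolding D_class_iff
  proof (intro conjI allI impI)
    fix B assume "B \<subseteq> pverts T"
    then obtain A where "A \<subseteq> {1..m}" "B = f ` A" using im by (metis subset_imageE)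
    then show "form_det (arc_form T) B \<le> k\<^sup>2" using sub pull by simp
  qed (use k T in auto)
  moreover have "T \<notin> D_class (k - 2)"
  proof
    assume "T \<in> D_class (k - 2)"
    moreover have "f ` A0 \<subseteq> pverts T" using big(1) im by auto
    ultimately have "k\<^sup>2 \<le> (k - 2)\<^sup>2"
      using big pull unfolding D_class_iff by metis
    then show False using k(2) by (simp add: power2_eq_square algebra_simps)
  qed
  moreover have "extend_tournament T u \<sigma> \<notin> D_class k"
    if u: "u \<notin> pverts T" and ncr: "\<not> CR_vertex T u \<sigma>" for u \<sigma>
  proof
    let ?E = "extend_tournament T u \<sigma>"
    assume E: "?E \<in> D_class k"
    have vE: "pverts ?E = insert u (pverts T)" by (simp add: extend_tournament_def)
    have tE: "tournament ?E" using E by (simp add: D_class_iff)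
    define g where "g = f(0 := u)"
    have "{0..m} = insert 0 {1..m}" by auto
    moreover have "g ` {1..m} = f ` {1..m}" by (rule image_cong) (auto simp: g_def)
    moreover have "g 0 = u" by (simp add: g_def)
    ultimately have gim: "g ` {0..m} = pverts ?E"
      using im vE by (metis image_insert)
    have ginj: "inj_on g {0..m}"
    proof (rule inj_onI)
      fix x y assume xy: "x \<in> {0..m}" "y \<in> {0..m}" "g x = g y"
      have fu: "f p \<noteq> u" if "0 < p" "p \<le> m" for p using that im u by (auto simp: Suc_le_eq)
      show "x = y"
        using xy fu[of x] fu[of y] inj_onD[OF inj, of x y] by (cases "x = 0"; cases "y = 0") (auto simp: g_def Suc_le_eq)
    qed
    have gf: "g p = f p" "f p \<in> pverts T" if "p \<in> {1..m}" for p
      using that im by (auto simp: g_def)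
    define S where "S = (\<lambda>x y. arc_form ?E (g x) (g y))"
    have "\<exists>w\<in>{1..m}. \<exists>s. (s = 1 \<or> s = - 1) \<and> (\<forall>p\<in>{1..m} - {w}. S 0 p = s * S w p)"
    proof (rule extend)
      show "skew S" unfolding S_def by (rule skew_comp[OF skew_arc_form])
      show "S x y = arc_form T (f x) (f y)" if "x \<in> {1..m}" "y \<in> {1..m}" for x y
      proof -
        have "f x \<noteq> u" "f y \<noteq> u" using gf that u by auto
        then show ?thesis
          using gf that by (simp add: S_def arc_form_def extend_tournament_def)
      qed
      show "S 0 p = 1 \<or> S 0 p = - 1" if "p \<in> {1..m}" for p
        unfolding S_def using gf[OF that] u
        by (intro arc_form_tournament(2)[OF tE]) (auto simp: vE g_def)
      show "form_det S A \<le> k\<^sup>2" if "A \<subseteq> {0..m}" for A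
      proof -
        have "form_det S A = form_det (arc_form ?E) (g ` A)"
          unfolding S_def
          by (rule form_det_image[symmetric]) (use that finite_subset inj_on_subset[OF ginj] in auto)
        moreover have "g ` A \<subseteq> pverts ?E"
          using image_mono[OF that, of g] gim by simp
        then have "form_det (arc_form ?E) (g ` A) \<le> k\<^sup>2"
          using E by (simp add: D_class_iff)
        ultimately show ?thesis by simp
      qed
    qed
    then obtain w s where ws: "w \<in> {1..m}" "s = 1 \<or> s = - 1"
      "\<And>p. p \<in> {1..m} - {w} \<Longrightarrow> S 0 p = s * S w p" by blast
    have "CR_associated ?E u (f w)"
    proof (rule CR_associated_proportional[OF tE _ _ _ _ ws(2)])
      show "u \<in> pverts ?E" "f w \<in> pverts ?E" "u \<noteq> f w"
        using vE gf[OF ws(1)] u by auto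
      have "card (pverts ?E) = m + 1"
        using card_image[OF ginj] gim by simp
      then show "3 \<le> card (pverts ?E)" using m by simp
      fix x assume "x \<in> pverts ?E - {u, f w}"
      then have "x \<in> f ` {1..m}" "x \<noteq> f w" using vE im by auto
      then obtain p where p: "p \<in> {1..m}" "x = f p" "p \<noteq> w" by blast
      then show "arc_form ?E u x = s * arc_form ?E (f w) x"
        using ws(3)[of p] gf[OF p(1)] gf[OF ws(1)] by (simp add: S_def g_def)
    qed
    then show False
      using ncr gf[OF ws(1)] unfolding CR_vertex_def by blast
  qed
  ultimately show ?thesis
    using k(1) unfolding CR_tournament_def by blast
qed

section \<open>L_n is basic and a CR tournament\<close>

lemma pverts_L_tournament [simp]: "pverts (L_tournament n) = {1..n}"
  by (simp add: L_tournament_def)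

lemma parcs_L_tournament:
  "(i, j) \<in> parcs (L_tournament n) \<longleftrightarrow> 1 \<le> i \<and> i < j \<and> j \<le> n - 1 \<or>
     i = n \<and> 1 \<le> j \<and> j \<le> n - 1 \<and> odd j \<or> j = n \<and> 1 \<le> i \<and> i \<le> n - 1 \<and> even i"
  by (auto simp: L_tournament_def)

lemma tournament_L_tournament: "tournament (L_tournament n)"
  unfolding tournament_def' by (auto simp: parcs_L_tournament)

lemma L_form_L_tournament:
  assumes "odd N" "3 \<le> N"
  shows "L_form N (arc_form (L_tournament (Suc N)))"
  using assms skew_arc_form
  by (auto simp: L_form_def arc_form_def parcs_L_tournament minus_one_power_iff)

lemma L_form_cong:
  assumes "L_form N S" "skew S'" "\<And>x y. x \<in> {1..Suc N} \<Longrightarrow> y \<in> {1..Suc N} \<Longrightarrow> S' x y = S x y"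
  shows "L_form N S'"
  using assms by (auto simp: L_form_def)

text \<open>For \<open>i\<close> and \<open>j\<close> on the path, a path vertex outside the stretch
  between them forces \<open>s = 1\<close>, one strictly inside forces \<open>s = - 1\<close>, and
  the apex forces \<open>s = (- 1) ^ (i + j)\<close>; as \<open>N\<close> is odd and at least 3,
  these clash. If \<open>j\<close> is the apex, its row alternates, while that of \<open>i\<close>
  changes sign only at \<open>i\<close>.\<close>

lemma L_form_basic:
  assumes L: "L_form N S" and ij: "i \<in> {1..Suc N}" "j \<in> {1..Suc N}" "i < j" and s: "s = 1 \<or> s = - 1"
  shows "\<exists>p\<in>{1..Suc N} - {i, j}. S i p \<noteq> s * S j p"
proof (rule ccontr)
  assume "\<not> ?thesis"
  then have eq: "S i p = s * S j p" if "p \<in> {1..Suc N}" "p \<noteq> i" "p \<noteq> j" for p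
    using that by blast
  have sk: "skew S" and N: "odd N" "3 \<le> N" using L by (auto simp: L_form_def)
  have path: "S p q = 1" "S q p = - 1" if "1 \<le> p" "p < q" "q \<le> N" for p q
    using L that skewD[OF sk, of q p] by (auto simp: L_form_def)
  have apex: "S p (Suc N) = (- 1) ^ p" "S (Suc N) p = - ((- 1) ^ p)" if "1 \<le> p" "p \<le> N" for p
    using L that skewD[OF sk, of p "Suc N"] by (auto simp: L_form_def)
  show False
  proof (cases "j = Suc N")
    case True
    have low: "s * (- 1) ^ p = 1" if "1 \<le> p" "p < i" for p
      using eq[of p] that ij True path(2)[of p i] apex(2)[of p] by auto
    have high: "s * (- 1) ^ p = - 1" if "i < p" "p \<le> N" for p
      using eq[of p] that ij True path(1)[of i p] apex(2)[of p] by auto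
    \<comment> \<open>The clash occurs at two adjacent positions on the same side of
      \<open>i\<close>, or for \<open>i = 2\<close> at the positions 1 and 3 of equal parity on
      different sides.\<close>
    consider "i = 1" | "i = 2" | "3 \<le> i" using ij by force
    then show False
    proof cases
      case 1 then show False using high[of 2] high[of 3] N s by auto
    next
      case 2 then show False using low[of 1] high[of 3] N s by auto
    next
      case 3 then show False using low[of 1] low[of 2] s by auto
    qed
  next
    case False
    then have j: "j \<le> N" "1 \<le> i" using ij by auto
    have out: "s = 1" if "1 \<le> p" "p \<le> N" "p < i \<or> j < p" for p
      using eq[of p] that ij j path[of p i] path[of p j] path[of i p] path[of j p] s by auto
    have mid: "s = - 1" if "i < p" "p < j" for p
      using eq[of p] that ij j path[of i p] path[of p j] s by auto
    have last: "(- 1) ^ i = s * (- 1) ^ j"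
      using eq[of "Suc N"] j ij apex(1)[of i] apex(1)[of j] by auto
    show False
    proof (cases "j = Suc i")
      case True
      then have "s = - 1" using last by (auto simp: minus_one_power_iff split: if_splits)
      moreover have "1 < i \<or> j < N" using True N j by auto
      then have "s = 1" using out[of 1] out[of N] j N by auto
      ultimately show False by simp
    next
      case False
      then have "s = - 1" using mid[of "Suc i"] ij by simp
      then have "i = 1" "j = N" using out[of 1] out[of N] j N by force+
      then show False using last \<open>s = - 1\<close> N by simp
    qed
  qed
qed

lemma CR_associated_sym: "CR_associated T u v \<Longrightarrow> CR_associated T v u"
  unfolding CR_associated_def covertices_def revertices_def
  by (elim disjE) (auto simp: Ball_def)

lemma basic_L_tournament:
  assumes N: "odd N" "3 \<le> N"
  shows "basic_tournament (L_tournament (Suc N))"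
proof -
  let ?T = "L_tournament (Suc N)"
  have T: "tournament ?T" by (rule tournament_L_tournament)
  have ncr: "\<not> CR_associated ?T i j" if ij: "i \<in> {1..Suc N}" "j \<in> {1..Suc N}" "i < j" for i j
  proof
    assume "CR_associated ?T i j"
    then obtain s :: int where s: "s = 1 \<or> s = - 1"
      and th: "\<And>p. p \<in> {1..Suc N} - {i, j} \<Longrightarrow> theta ?T i p = s * theta ?T j p"
      unfolding CR_associated_def covertices_def revertices_def using N(2)
      by (auto; metis mult_1 mult_minus1)
    obtain p where p: "p \<in> {1..Suc N} - {i, j}" "arc_form ?T i p \<noteq> s * arc_form ?T j p"
      using L_form_basic[OF L_form_L_tournament[OF N] ij s] by blast
    then show False
      using th[OF p(1)] arc_form_tournament(1)[OF T, of i p] arc_form_tournament(1)[OF T, of j p] ij by auto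
  qed
  have "\<not> CR_associated ?T i j" if "i \<in> {1..Suc N}" "j \<in> {1..Suc N}" "i \<noteq> j" for i j
    using ncr[of i j] ncr[of j i] CR_associated_sym[of ?T i j] that by (meson nat_neq_iff)
  then show ?thesis
    unfolding basic_tournament_def using T N(2) by simp
qed

lemma CR_L_tournament:
  assumes N: "odd N" "3 \<le> N"
  shows "CR_tournament (L_tournament (Suc N))"
proof (rule CR_tournamentI[where f=id and m="Suc N" and k="int N" and ?A0.0="{1..Suc N}"])
  let ?S = "\<lambda>x y. arc_form (L_tournament (Suc N)) (id x) (id y)"
  have L: "L_form N ?S" using L_form_L_tournament[OF N] by simp
  then have sk: "skew ?S" by (simp add: L_form_def)
  show "form_det ?S A \<le> (int N)\<^sup>2" if A: "A \<subseteq> {1..Suc N}" for A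
  proof (cases "even (card A)")
    case True
    show ?thesis
      by (rule L_form_sub_det[OF L A True]) (use N card_mono[OF _ A] in auto)
  qed (use form_det_odd[OF sk] in auto)
  show "form_det ?S {1..Suc N} = (int N)\<^sup>2" by (rule L_form_det[OF L])
  show "\<exists>w\<in>{1..Suc N}. \<exists>s. (s = 1 \<or> s = - 1) \<and> (\<forall>p\<in>{1..Suc N} - {w}. S 0 p = s * S w p)"
    if S: "skew S" "\<And>x y. x \<in> {1..Suc N} \<Longrightarrow> y \<in> {1..Suc N} \<Longrightarrow> S x y = ?S x y"
      "\<And>p. p \<in> {1..Suc N} \<Longrightarrow> S 0 p = 1 \<or> S 0 p = - 1"
      "\<And>A. A \<subseteq> {0..Suc N} \<Longrightarrow> form_det S A \<le> (int N)\<^sup>2" for S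
  proof -
    have LS: "L_form N S" by (rule L_form_cong[OF L S(1)]) (rule S(2))
    show ?thesis
      by (rule L_form_extension[OF LS]) (rule S(3), assumption, rule S(4), assumption, blast)
  qed
qed (use N tournament_L_tournament in \<open>auto simp: bij_betw_def\<close>)

section \<open>1-transitive blowups of L_n\<close>

lemma tournament_transitive_blowup:
  assumes "tournament T"
  shows "tournament (transitive_blowup T a)"
proof -
  have *: "finite (pverts T)" "parcs T \<subseteq> pverts T \<times> pverts T" "\<And>u. (u, u) \<notin> parcs T"
    "\<And>u v. u \<in> pverts T \<Longrightarrow> v \<in> pverts T \<Longrightarrow> u \<noteq> v \<Longrightarrow> ((u, v) \<in> parcs T) \<noteq> ((v, u) \<in> parcs T)"
    using assms unfolding tournament_def' by blast+
  show ?thesis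
    unfolding tournament_def'
  proof (intro conjI ballI impI allI)
    show "finite (pverts (transitive_blowup T a))"
      using *(1) by (simp add: transitive_blowup_def)
    show "parcs (transitive_blowup T a) \<subseteq> pverts (transitive_blowup T a) \<times> pverts (transitive_blowup T a)"
      by (auto simp: transitive_blowup_def)
    show "(x, x) \<notin> parcs (transitive_blowup T a)" for x
      using *(3) by (auto simp: transitive_blowup_def)
    fix x y assume xy: "x \<in> pverts (transitive_blowup T a)" "y \<in> pverts (transitive_blowup T a)" "x \<noteq> y"
    obtain v i w j where vw: "x = (v, i)" "y = (w, j)" by (cases x, cases y)
    show "((x, y) \<in> parcs (transitive_blowup T a)) \<noteq> ((y, x) \<in> parcs (transitive_blowup T a))"
      using xy *(3)[of v] *(4)[of v w] unfolding vw
      by (cases "v = w") (auto simp: transitive_blowup_def)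
  qed
qed

lemma CR_blowup_L_tournament:
  assumes N: "odd N" "3 \<le> N" and B: "B \<in> one_transitive_blowups (L_tournament (Suc N))"
  shows "CR_tournament B"
proof -
  let ?T = "L_tournament (Suc N)" and ?v' = "Suc (Suc N)"
  obtain a v where a: "B = transitive_blowup ?T a" "v \<in> {1..Suc N}" "a v = 2"
    "\<And>w. w \<in> {1..Suc N} \<Longrightarrow> w \<noteq> v \<Longrightarrow> a w = 1"
    using B unfolding one_transitive_blowups_def by auto
  have tT: "tournament ?T" by (rule tournament_L_tournament)
  then have tB: "tournament B" unfolding a(1) by (rule tournament_transitive_blowup)
  have noloop: "(x, x) \<notin> parcs ?T" for x using tT unfolding tournament_def' by blast
  have a1: "1 \<le> a x" if "x \<in> {1..Suc N}" for x using a(3,4) that by (cases "x = v") auto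
  \<comment> \<open>The first copy of a vertex keeps its label; the second copy of \<open>v\<close>
    gets the last label, as in \<open>twin_form\<close>.\<close>
  define f where "f x = (if x = ?v' then (v, 2) else (x, 1 :: nat))" for x
  have bij: "bij_betw f {1..?v'} (pverts B)"
    unfolding bij_betw_def
  proof
    show "inj_on f {1..?v'}" by (auto simp: inj_on_def f_def)
    have "pverts B = insert (v, 2) ((\<lambda>x. (x, 1)) ` {1..Suc N})"
    proof (rule Set.set_eqI)
      fix z :: "nat \<times> nat"
      obtain x i where z: "z = (x, i)" by (cases z)
      show "z \<in> pverts B \<longleftrightarrow> z \<in> insert (v, 2) ((\<lambda>x. (x, 1)) ` {1..Suc N})"
        using a(2,3) a(4)[of x] unfolding z a(1)
        by (cases "x = v") (auto simp: transitive_blowup_def image_iff)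
    qed
    also have "\<dots> = f ` {1..?v'}"
      by (subst atLeastAtMostSuc_conv) (auto simp: f_def)
    finally show "f ` {1..?v'} = pverts B" by simp
  qed
  define S0 where "S0 = (\<lambda>x y. arc_form B (f x) (f y))"
  have S0T: "S0 x y = arc_form ?T x y" if "x \<in> {1..Suc N}" "y \<in> {1..Suc N}" for x y
    using that a1[OF that(1)] a1[OF that(2)]
    by (auto simp: S0_def f_def arc_form_def a(1) transitive_blowup_def)
  have sk0: "skew S0" unfolding S0_def by (rule skew_comp[OF skew_arc_form])
  have L0: "L_form N S0"
    by (rule L_form_cong[OF L_form_L_tournament[OF N] sk0]) (rule S0T)
  have tw0: "twin_form N S0 v"
    unfolding twin_form_def
  proof (intro conjI ballI)
    show "S0 v ?v' = 1"
      using a(2,3) noloop[of v] by (auto simp: S0_def f_def arc_form_def a(1) transitive_blowup_def)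
    fix q assume q: "q \<in> {1..Suc N} - {v}"
    then have "S0 v q = arc_form ?T v q" using a(2) S0T by simp
    moreover have "S0 ?v' q = arc_form ?T v q"
      using q a(2,3) a1[of q] by (auto simp: S0_def f_def arc_form_def a(1) transitive_blowup_def)
    ultimately show "S0 ?v' q = S0 v q" by simp
  qed (use L0 a(2) in auto)
  \<comment> \<open>The labels \<open>1..Suc N\<close> carry a copy of L_n, which still attains
    \<open>N\<^sup>2\<close>, so \<open>k\<close> is the same as for L_n.\<close>
  show ?thesis
  proof (rule CR_tournamentI[where f=f and m="?v'" and k="int N" and ?A0.0="{1..Suc N}"])
    show "form_det (\<lambda>x y. arc_form B (f x) (f y)) A \<le> (int N)\<^sup>2" if A: "A \<subseteq> {1..?v'}" for A
      unfolding S0_def[symmetric]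
    proof (cases "even (card A)")
      case True
      show "form_det S0 A \<le> (int N)\<^sup>2" by (rule twin_form_sub_det[OF tw0 A True])
    next
      case False
      then show "form_det S0 A \<le> (int N)\<^sup>2" using form_det_odd[OF sk0] by simp
    qed
    show "form_det (\<lambda>x y. arc_form B (f x) (f y)) {1..Suc N} = (int N)\<^sup>2"
      unfolding S0_def[symmetric] by (rule L_form_det[OF L0])
    show "\<exists>w\<in>{1..?v'}. \<exists>s. (s = 1 \<or> s = - 1) \<and> (\<forall>p\<in>{1..?v'} - {w}. S 0 p = s * S w p)"
      if S: "skew S" "\<And>x y. x \<in> {1..?v'} \<Longrightarrow> y \<in> {1..?v'} \<Longrightarrow> S x y = arc_form B (f x) (f y)"
        "\<And>p. p \<in> {1..?v'} \<Longrightarrow> S 0 p = 1 \<or> S 0 p = - 1"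
        "\<And>A. A \<subseteq> {0..?v'} \<Longrightarrow> form_det S A \<le> (int N)\<^sup>2" for S
    proof -
      have eq: "S x y = S0 x y" if "x \<in> {1..?v'}" "y \<in> {1..?v'}" for x y
        using S(2) that by (simp add: S0_def)
      have "L_form N S" by (rule L_form_cong[OF L0 S(1)]) (rule eq, auto)
      moreover have "S v ?v' = 1"
        using eq[of v ?v'] tw0 a(2) by (simp add: twin_form_def)
      moreover have "S ?v' q = S v q" if "q \<in> {1..Suc N} - {v}" for q
        using eq[of ?v' q] eq[of v q] tw0 a(2) that by (simp add: twin_form_def)
      ultimately have TS: "twin_form N S v"
        using a(2) unfolding twin_form_def by blast
      show ?thesis
        by (rule twin_form_extension[OF TS]) (rule S(3), assumption, rule S(4), assumption, blast)
    qed
    show "tournament B" by (rule tB)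
    show "bij_betw f {1..?v'} (pverts B)" by (rule bij)
    show "odd (int N)" "3 \<le> int N" "2 \<le> ?v'" "{1..Suc N} \<subseteq> {1..?v'}" using N by simp_all
  qed
qed

theorem theorem6p1:
  fixes n :: nat
  assumes "n \<ge> 4" and "even n"
  shows "basic_tournament (L_tournament n) \<and> strong_CR_tournament (L_tournament n)"
proof -
  obtain N where N: "n = Suc N" "odd N" "3 \<le> N"
    using assms by (cases n) auto
  show ?thesis
    unfolding N(1) strong_CR_tournament_def
    using basic_L_tournament[OF N(2,3)] CR_L_tournament[OF N(2,3)] CR_blowup_L_tournament[OF N(2,3)]
    by simp
qed

end
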